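(* The class of $\omega$-languages recognized by deterministic limit Parikh automata is closed under union, intersection and complement. That is, for every finite non-empty alphabet $\Sigma$ and all $L_1, L_2 \subseteq \Sigma^\omega$ recognized by deterministic limit Parikh automata, each of $L_1 \cup L_2$, $L_1 \cap L_2$ and $\Sigma^\omega \setminus L_1$ is recognized by a deterministic limit Parikh automaton.
   Context: $\mathbb{N}=\{0,1,2,\dots\}$ and $\mathbb{N}_\infty=\mathbb{N}\cup\{\infty\}$, with $z+\infty=\infty+z=\infty+\infty=\infty$ for $z\in\mathbb{N}$, $z\cdot\infty=\infty\cdot z=\infty$ for $z\ge 1$, and $0\cdot\infty=\infty\cdot 0=0$; operations on vectors are component-wise. A linear set over $\mathbb{N}_\infty^d$ is a set $C(\mathbf{b},P)=\{\mathbf{b}+\mathbf{p}_1z_1+\dots+\mathbf{p}_\ell z_\ell \mid z_1,\dots,z_\ell\in\mathbb{N}\}$ with $\mathbf{b}\in\mathbb{N}_\infty^d$ and $P=\{\mathbf{p}_1,\dots,\mathbf{p}_\ell\}\subseteq\mathbb{N}_\infty^d$ finite ($\ell\ge 0$); a semi-linear set is a finite union of linear sets. A limit Parikh automaton (limit PA) of dimension $d\ge 1$ is a tuple $\mathcal{A}=(Q,\Sigma,q_0,\Delta,F,C)$ with a finite state set $Q$, a finite alphabet $\Sigma$, an initial state $q_0\in Q$, a finite set of labeled transitions $\Delta\subseteq Q\times\Sigma\times\mathbb{N}^d\times Q$, a set of accepting states $F\subseteq Q$, and a semi-linear set $C\subseteq\mathbb{N}_\infty^d$. It is deterministic if for every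 $(p,a)\in Q\times\Sigma$ there is exactly one transition $(p,a,\mathbf{v},q)\in\Delta$. A run on $\alpha=\alpha_1\alpha_2\dots\in\Sigma^\omega$ is an infinite sequence $r=r_1r_2\dots$ with $r_i=(p_{i-1},\alpha_i,\mathbf{v}_i,p_i)\in\Delta$ and $p_0=q_0$. It is accepting if $p_i\in F$ for infinitely many $i\ge 1$ and $\rho(r)\in C$, where the $j$th component of $\rho(r)\in\mathbb{N}_\infty^d$ is $\infty$ if infinitely many $\mathbf{v}_i$ have a non-zero $j$th component, and otherwise is the (finite) sum of the $j$th components of all $\mathbf{v}_i$. The recognized $\omega$-language is $L_\omega(\mathcal{A})=\{\alpha\in\Sigma^\omega\mid\text{there is an accepting run of }\mathcal{A}\text{ on }\alpha\}$. *)

theory Defs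
  imports "HOL-Library.Extended_Nat" "HOL-Library.Omega_Words_Fun"
begin

text \<open>
  Vectors over the naturals and over \<^typ>\<open>enat\<close> are lists; membership in the \<open>d\<close>-dimensional space
  means having length \<open>d\<close>. The multiplication of \<^typ>\<open>enat\<close> satisfies \<open>0 * \<infinity> = \<infinity> * 0 = 0\<close>.
\<close>

definition linear_comb :: "nat \<Rightarrow> enat list \<Rightarrow> enat list set \<Rightarrow> (enat list \<Rightarrow> nat) \<Rightarrow> enat list" where
  "linear_comb d b P z = map (\<lambda>j. b ! j + (\<Sum>p\<in>P. p ! j * enat (z p))) [0..<d]"

definition linear_set :: "nat \<Rightarrow> enat list set \<Rightarrow> bool" where
  "linear_set d X \<longleftrightarrow>
     (\<exists>b P. length b = d \<and> finite P \<and> (\<forall>p\<in>P. length p = d) \<and> X = range (linear_comb d b P))"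

definition semilinear_set :: "nat \<Rightarrow> enat list set \<Rightarrow> bool" where
  "semilinear_set d C \<longleftrightarrow> (\<exists>\<X>. finite \<X> \<and> (\<forall>X\<in>\<X>. linear_set d X) \<and> C = \<Union>\<X>)"

type_synonym ('q, 'a) transition = "'q \<times> 'a \<times> nat list \<times> 'q"

fun source :: "('q, 'a) transition \<Rightarrow> 'q" where "source (p, a, v, q) = p"
fun letter :: "('q, 'a) transition \<Rightarrow> 'a" where "letter (p, a, v, q) = a"
fun weight :: "('q, 'a) transition \<Rightarrow> nat list" where "weight (p, a, v, q) = v"
fun target :: "('q, 'a) transition \<Rightarrow> 'q" where "target (p, a, v, q) = q"

record ('q, 'a) parikh_automaton =
  dim :: nat
  states :: "'q set"
  alphabet :: "'a set"
  initial :: 'q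
  transitions :: "('q, 'a) transition set"
  accepting :: "'q set"
  constraint :: "enat list set"

definition limit_PA :: "('q, 'a) parikh_automaton \<Rightarrow> bool" where
  "limit_PA A \<longleftrightarrow>
     1 \<le> dim A \<and>
     finite (states A) \<and>
     finite (alphabet A) \<and>
     initial A \<in> states A \<and>
     finite (transitions A) \<and>
     transitions A \<subseteq> states A \<times> alphabet A \<times> {v. length v = dim A} \<times> states A \<and>
     accepting A \<subseteq> states A \<and>
     semilinear_set (dim A) (constraint A)"

definition deterministic :: "('q, 'a) parikh_automaton \<Rightarrow> bool" where
  "deterministic A \<longleftrightarrow>
     (\<forall>p\<in>states A. \<forall>a\<in>alphabet A. \<exists>!t. t \<in> transitions A \<and> source t = p \<and> letter t = a)"

text \<open>
  Words and runs are indexed from \<open>0\<close>: \<open>r i\<close> is the transition reading the letter \<open>\<alpha> i\<close>, and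
  \<open>target (r i)\<close> is the state reached after \<open>i + 1\<close> letters.
\<close>

definition omega_words :: "'a set \<Rightarrow> 'a word set" where
  "omega_words \<Sigma> = {\<alpha>. range \<alpha> \<subseteq> \<Sigma>}"

definition is_run :: "('q, 'a) parikh_automaton \<Rightarrow> 'a word \<Rightarrow> ('q, 'a) transition word \<Rightarrow> bool" where
  "is_run A \<alpha> r \<longleftrightarrow>
     (\<forall>i. r i \<in> transitions A \<and> letter (r i) = \<alpha> i) \<and>
     source (r 0) = initial A \<and>
     (\<forall>i. source (r (Suc i)) = target (r i))"

definition total_weight :: "nat \<Rightarrow> ('q, 'a) transition word \<Rightarrow> enat list" where
  "total_weight d r =
     map (\<lambda>j. if infinite {i. weight (r i) ! j \<noteq> 0} then \<infinity>
              else enat (\<Sum>i\<in>{i. weight (r i) ! j \<noteq> 0}. weight (r i) ! j)) [0..<d]"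

definition accepting_run :: "('q, 'a) parikh_automaton \<Rightarrow> ('q, 'a) transition word \<Rightarrow> bool" where
  "accepting_run A r \<longleftrightarrow>
     infinite {i. target (r i) \<in> accepting A} \<and> total_weight (dim A) r \<in> constraint A"

definition omega_language :: "('q, 'a) parikh_automaton \<Rightarrow> 'a word set" where
  "omega_language A =
     {\<alpha> \<in> omega_words (alphabet A). \<exists>r. is_run A \<alpha> r \<and> accepting_run A r}"

text \<open>
  Since state sets are finite, it is no restriction to take the states from the naturals; the
  theorem \<open>det_limit_PA_recognizableI\<close> below shows that automata over arbitrary state types
  recognize nothing more.
\<close>

definition det_limit_PA_recognizable :: "'a set \<Rightarrow> 'a word set \<Rightarrow> bool" where
  "det_limit_PA_recognizable \<Sigma> L \<longleftrightarrow>
     (\<exists>A :: (nat, 'a) parikh_automaton.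
        limit_PA A \<and> deterministic A \<and> alphabet A = \<Sigma> \<and> omega_language A = L)"

fun map_transition :: "('q \<Rightarrow> 'p) \<Rightarrow> ('q, 'a) transition \<Rightarrow> ('p, 'a) transition" where
  "map_transition f (p, a, v, q) = (f p, a, v, f q)"

definition map_automaton :: "('q \<Rightarrow> 'p) \<Rightarrow> ('q, 'a) parikh_automaton \<Rightarrow> ('p, 'a) parikh_automaton" where
  "map_automaton f A =
     \<lparr>dim = dim A, states = f ` states A, alphabet = alphabet A, initial = f (initial A),
      transitions = map_transition f ` transitions A, accepting = f ` accepting A,
      constraint = constraint A\<rparr>"

lemma map_automaton_sel [simp]:
  "dim (map_automaton f A) = dim A"
  "states (map_automaton f A) = f ` states A"
  "alphabet (map_automaton f A) = alphabet A"
  "initial (map_automaton f A) = f (initial A)"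
  "transitions (map_automaton f A) = map_transition f ` transitions A"
  "accepting (map_automaton f A) = f ` accepting A"
  "constraint (map_automaton f A) = constraint A"
  by (simp_all add: map_automaton_def)

lemma map_transition_sel [simp]:
  "source (map_transition f t) = f (source t)"
  "letter (map_transition f t) = letter t"
  "weight (map_transition f t) = weight t"
  "target (map_transition f t) = f (target t)"
  by (cases t; simp)+

lemma transition_states:
  assumes "limit_PA A" "t \<in> transitions A"
  shows "source t \<in> states A" "target t \<in> states A"
  using assms by (cases t; auto simp: limit_PA_def)+

lemma limit_PA_map_automaton:
  assumes "limit_PA A"
  shows "limit_PA (map_automaton f A)"
proof -
  have "transitions (map_automaton f A)
      \<subseteq> f ` states A \<times> alphabet A \<times> {v. length v = dim A} \<times> f ` states A"
  proof
    fix t assume "t \<in> transitions (map_automaton f A)"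
    then obtain s where s: "s \<in> transitions A" "t = map_transition f s" by auto
    obtain p a v q where "s = (p, a, v, q)" by (cases s)
    with s assms show "t \<in> f ` states A \<times> alphabet A \<times> {v. length v = dim A} \<times> f ` states A"
      by (auto simp: limit_PA_def)
  qed
  with assms show ?thesis by (auto simp: limit_PA_def)
qed

lemma deterministic_map_automaton:
  assumes "limit_PA A" "deterministic A" "inj_on f (states A)"
  shows "deterministic (map_automaton f A)"
  unfolding deterministic_def
proof (intro ballI)
  fix p' a assume "p' \<in> states (map_automaton f A)" and a: "a \<in> alphabet (map_automaton f A)"
  then obtain p where p: "p \<in> states A" "p' = f p" by auto
  from assms(2) p(1) a obtain t where t: "t \<in> transitions A" "source t = p" "letter t = a"
    and uniq: "\<And>s. s \<in> transitions A \<Longrightarrow> source s = p \<Longrightarrow> letter s = a \<Longrightarrow> s = t"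
    unfolding deterministic_def by (metis map_automaton_sel(3))
  show "\<exists>!t. t \<in> transitions (map_automaton f A) \<and> source t = p' \<and> letter t = a"
  proof (rule ex1I[of _ "map_transition f t"])
    fix u assume u: "u \<in> transitions (map_automaton f A) \<and> source u = p' \<and> letter u = a"
    then obtain s where s: "s \<in> transitions A" "u = map_transition f s" by auto
    with u p have "f (source s) = f p" "letter s = a" by auto
    then have "source s = p"
      using inj_onD[OF assms(3)] transition_states(1)[OF assms(1) s(1)] p(1) by blast
    then show "u = map_transition f t" using uniq s \<open>letter s = a\<close> by blast
  qed (use t p in auto)
qed

lemma total_weight_map_transition [simp]:
  "total_weight d (\<lambda>i. map_transition f (r i)) = total_weight d r"
  by (simp add: total_weight_def)

lemma omega_language_map_automaton:
  assumes A: "limit_PA A" and inj: "inj_on f (states A)"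
  shows "omega_language (map_automaton f A) = omega_language A"
proof -
  have acc: "f q \<in> f ` accepting A \<longleftrightarrow> q \<in> accepting A" if "q \<in> states A" for q
    using that A inj by (auto simp: limit_PA_def inj_on_def)
  have lift: "is_run (map_automaton f A) \<alpha> (\<lambda>i. map_transition f (r i)) \<longleftrightarrow> is_run A \<alpha> r"
    and lift_acc: "accepting_run (map_automaton f A) (\<lambda>i. map_transition f (r i))
        \<longleftrightarrow> accepting_run A r"
    if r: "\<And>i. r i \<in> transitions A" for \<alpha> r
  proof -
    note st = transition_states[OF A r]
    have "initial A \<in> states A" using A by (simp add: limit_PA_def)
    then show "is_run (map_automaton f A) \<alpha> (\<lambda>i. map_transition f (r i)) \<longleftrightarrow> is_run A \<alpha> r"
      using r by (simp add: is_run_def inj_on_eq_iff[OF inj] st)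
    show "accepting_run (map_automaton f A) (\<lambda>i. map_transition f (r i))
        \<longleftrightarrow> accepting_run A r"
      by (simp add: accepting_run_def acc st)
  qed
  have "(\<exists>r. is_run (map_automaton f A) \<alpha> r \<and> accepting_run (map_automaton f A) r)
      \<longleftrightarrow> (\<exists>r. is_run A \<alpha> r \<and> accepting_run A r)" for \<alpha>
  proof
    assume "\<exists>r. is_run (map_automaton f A) \<alpha> r \<and> accepting_run (map_automaton f A) r"
    then obtain r where r: "is_run (map_automaton f A) \<alpha> r"
      "accepting_run (map_automaton f A) r" by blast
    then have "\<forall>i. \<exists>t. t \<in> transitions A \<and> r i = map_transition f t"
      unfolding is_run_def map_automaton_sel by blast
    then obtain s where s: "\<And>i. s i \<in> transitions A" "\<And>i. r i = map_transition f (s i)"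
      by metis
    then have eq: "r = (\<lambda>i. map_transition f (s i))" by auto
    have "is_run A \<alpha> s" using r(1) lift[of s \<alpha>] s(1) unfolding eq by simp
    moreover have "accepting_run A s" using r(2) lift_acc[of s] s(1) unfolding eq by simp
    ultimately show "\<exists>r. is_run A \<alpha> r \<and> accepting_run A r" by blast
  next
    assume "\<exists>r. is_run A \<alpha> r \<and> accepting_run A r"
    then obtain r where r: "is_run A \<alpha> r" "accepting_run A r" by blast
    then have tr: "r i \<in> transitions A" for i by (simp add: is_run_def)
    have "is_run (map_automaton f A) \<alpha> (\<lambda>i. map_transition f (r i))"
      using r(1) lift[of r \<alpha>] tr by simp
    moreover have "accepting_run (map_automaton f A) (\<lambda>i. map_transition f (r i))"
      using r(2) lift_acc[of r] tr by simp
    ultimately show "\<exists>r. is_run (map_automaton f A) \<alpha> r \<and> accepting_run (map_automaton f A) r" by blast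
  qed
  then show ?thesis by (simp add: omega_language_def)
qed

theorem det_limit_PA_recognizableI:
  fixes A :: "('q, 'a) parikh_automaton"
  assumes "limit_PA A" "deterministic A"
  shows "det_limit_PA_recognizable (alphabet A) (omega_language A)"
proof -
  have "finite (states A)" using assms(1) by (simp add: limit_PA_def)
  from finite_imp_inj_to_nat_seg[OF this]
  obtain f :: "'q \<Rightarrow> nat" where "inj_on f (states A)" by blast
  with assms show ?thesis
    unfolding det_limit_PA_recognizable_def
    by (intro exI[of _ "map_automaton f A"])
      (simp add: limit_PA_map_automaton deterministic_map_automaton omega_language_map_automaton)
qed

end

theory Submission
  imports Defs "HOL-Library.Multiset" "HOL-Decision_Procs.Cooper"
begin

text \<open>
  A deterministic automaton has exactly one run on every word, so it suffices to form Boolean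
  combinations of acceptance conditions on the runs of a product automaton. Buechi acceptance is
  turned into a condition on the counters: an additional counter is incremented at each visit of an
  accepting state, and the run is accepting iff this counter is infinite. What remains is that
  semilinear sets over \<^typ>\<open>enat\<close> are closed under complement. Fixing the set \<open>J\<close> of infinite
  components reduces this to sets of vectors of naturals, where semilinearity coincides with
  definability in Presburger arithmetic: after quantifier elimination (by Cooper's verified
  algorithm), a quantifier-free formula is a Boolean combination of inequalities and divisibilities
  of affine functions, and by Dickson's lemma each of these cuts a semilinear set out of a
  semilinear set.
\<close>

hide_const (open) Cooper.C Cooper.E Cooper.A Cooper.T Cooper.F
  Cooper.\<alpha> Cooper.\<beta> Cooper.\<delta>

section \<open>Semilinear sets of finite multisets\<close>

inductive_set gen :: "'v::comm_monoid_add set \<Rightarrow> 'v set" for P where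
  gen_zero [simp]: "0 \<in> gen P"
| gen_step: "p \<in> P \<Longrightarrow> x \<in> gen P \<Longrightarrow> p + x \<in> gen P"

lemma gen_base: "p \<in> P \<Longrightarrow> p \<in> gen P"
  using gen_step[of p P 0] by simp

lemma gen_add: "x \<in> gen P \<Longrightarrow> y \<in> gen P \<Longrightarrow> x + y \<in> gen P"
  by (induction x rule: gen.induct) (auto simp: add.assoc intro: gen_step)

lemma gen_mono: "P \<subseteq> Q \<Longrightarrow> gen P \<subseteq> gen Q"
proof
  fix x assume "P \<subseteq> Q" "x \<in> gen P"
  from this(2,1) show "x \<in> gen Q" by (induction rule: gen.induct) (auto intro: gen_step)
qed

lemma gen_least:
  assumes "P \<subseteq> K" "0 \<in> K" "\<And>x y. x \<in> K \<Longrightarrow> y \<in> K \<Longrightarrow> x + y \<in> K"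
  shows "gen P \<subseteq> K"
proof
  fix x assume "x \<in> gen P"
  then show "x \<in> K" by (induction rule: gen.induct) (use assms in auto)
qed

text \<open>By commutativity all copies of \<open>p\<close> can be moved to the front, and
  \<open>k\<close> counts them. A plain commutative monoid has no scalar multiples, so iterated
  addition stands in for them.\<close>

lemma gen_insertE:
  assumes "x \<in> gen (insert p P)"
  obtains k y where "y \<in> gen P" "x = ((+) p ^^ k) y"
proof -
  have shift: "q + ((+) p ^^ k) y = ((+) p ^^ k) (q + y)" for q k y
    by (induction k) (auto simp: add.left_commute)
  from assms have "\<exists>k. \<exists>y\<in>gen P. x = ((+) p ^^ k) y"
  proof (induction rule: gen.induct)
    case gen_zero
    show ?case by (rule exI[of _ 0]) auto
  next
    case (gen_step q x)
    then obtain k y where y: "y \<in> gen P" "x = ((+) p ^^ k) y" by blast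
    show ?case
    proof (cases "q = p")
      case True
      then have "q + x = ((+) p ^^ Suc k) y" using y by simp
      then show ?thesis using y by blast
    next
      case False
      then have "q + y \<in> gen P" using gen_step y gen.gen_step by blast
      moreover have "q + x = ((+) p ^^ k) (q + y)" using y shift by simp
      ultimately show ?thesis by blast
    qed
  qed
  with that show thesis by blast
qed

section \<open>Monotone subsequences and Dickson's lemma\<close>

text \<open>Select indices whose value is minimal among all later values; they exist beyond every
  bound, since each tail of the sequence attains its minimum.\<close>

lemma mono_subseq_nat:
  fixes s :: "nat \<Rightarrow> nat"
  shows "\<exists>\<phi>::nat \<Rightarrow> nat. strict_mono \<phi> \<and> (\<forall>i j. i < j \<longrightarrow> s (\<phi> i) \<le> s (\<phi> j))"
proof -
  have ex: "\<exists>n\<ge>N. \<forall>m\<ge>n. s n \<le> s m" for N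
  proof -
    obtain n where "n \<ge> N" "\<And>m. m \<ge> N \<Longrightarrow> s n \<le> s m"
      using ex_has_least_nat[of "\<lambda>n. n \<ge> N" N s] by blast
    then show ?thesis by (meson order_trans)
  qed
  have "\<exists>\<phi>. \<forall>n. (\<forall>m\<ge>\<phi> n. s (\<phi> n) \<le> s m) \<and> \<phi> n < \<phi> (Suc n)"
  proof (rule dependent_nat_choice)
    show "\<exists>n. \<forall>m\<ge>n. s n \<le> s m" using ex by blast
    fix x show "\<exists>y. (\<forall>m\<ge>y. s y \<le> s m) \<and> x < y" using ex[of "Suc x"] by (auto simp: Suc_le_eq)
  qed
  then obtain \<phi> where \<phi>: "\<And>n m. m \<ge> \<phi> n \<Longrightarrow> s (\<phi> n) \<le> s m" "\<And>n. \<phi> n < \<phi> (Suc n)" by blast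
  then have "strict_mono \<phi>" by (simp add: strict_mono_Suc_iff)
  with \<phi>(1) show ?thesis by (intro exI[of _ \<phi>]) (auto simp: strict_mono_less_eq)
qed

text \<open>Dickson's lemma for the divisibility order of a finitely generated monoid.\<close>

lemma gen_subseq:
  assumes "finite P" "\<And>n::nat. x n \<in> gen P"
  shows "\<exists>\<phi>::nat \<Rightarrow> nat. strict_mono \<phi> \<and> (\<forall>i j. i < j \<longrightarrow> x (\<phi> j) \<in> (+) (x (\<phi> i)) ` gen P)"
  using assms
proof (induction P arbitrary: x)
  case empty
  have "x n = 0" for n using empty[of n] by (auto elim: gen.cases)
  then show ?case by (intro exI[of _ id]) (auto simp: strict_mono_def intro: image_eqI[of _ _ 0])
next
  case (insert p P)
  have "\<forall>n. \<exists>k y. y \<in> gen P \<and> x n = ((+) p ^^ k) y" using insert.prems gen_insertE by metis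
  then obtain k y where y: "\<And>n. y n \<in> gen P" "\<And>n. x n = ((+) p ^^ k n) (y n)" by metis
  \<comment> \<open>Thin out twice: \<open>\<phi>\<close> makes the parts generated by
    \<open>P\<close> divide each other, and \<open>\<psi>\<close> then makes the number of copies of
    \<open>p\<close> nondecreasing.\<close>
  obtain \<phi> :: "nat \<Rightarrow> nat" where \<phi>: "strict_mono \<phi>" "\<And>i j. i < j \<Longrightarrow> y (\<phi> j) \<in> (+) (y (\<phi> i)) ` gen P"
    using insert.IH[of y] y by blast
  obtain \<psi> :: "nat \<Rightarrow> nat" where \<psi>: "strict_mono \<psi>" "\<And>i j. i < j \<Longrightarrow> k (\<phi> (\<psi> i)) \<le> k (\<phi> (\<psi> j))"
    using mono_subseq_nat[of "k \<circ> \<phi>"] by (auto simp: o_def)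
  have shift: "((+) p ^^ n) (u + v) = ((+) p ^^ n) u + v" for n u v
    by (induction n) (auto simp: add.assoc)
  have pow: "((+) p ^^ n) u \<in> gen (insert p P)" if "u \<in> gen (insert p P)" for n u
    using that by (induction n) (auto intro: gen_step)
  have "x (\<phi> (\<psi> j)) \<in> (+) (x (\<phi> (\<psi> i))) ` gen (insert p P)" if "i < j" for i j
  proof -
    let ?i = "\<phi> (\<psi> i)" and ?j = "\<phi> (\<psi> j)"
    from that \<psi>(1) have "\<psi> i < \<psi> j" by (simp add: strict_mono_less)
    then obtain u where u: "u \<in> gen P" "y ?j = y ?i + u" using \<phi>(2) by blast
    from \<psi>(2)[OF that] obtain l where l: "k ?j = k ?i + l" using le_Suc_ex by blast
    have "x ?j = ((+) p ^^ k ?i) (((+) p ^^ l) (u + y ?i))"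
      unfolding y(2) l u(2) by (simp add: funpow_add add.commute[of u])
    also have "\<dots> = x ?i + ((+) p ^^ l) u"
      by (metis add.commute shift y(2))
    finally show ?thesis using pow[of u l] u gen_mono[of P "insert p P"] by blast
  qed
  moreover have "strict_mono (\<lambda>i. \<phi> (\<psi> i))" using strict_mono_o[OF \<phi>(1) \<psi>(1)] by (simp add: o_def)
  ultimately show ?case by (intro exI[of _ "\<lambda>i. \<phi> (\<psi> i)"]) auto
qed

text \<open>One more thinning makes \<open>s\<close> monotone as well; the first two terms of the
  resulting subsequence form the pair.\<close>

lemma gen_good_pair:
  fixes s :: "'v::comm_monoid_add \<Rightarrow> nat" and x :: "nat \<Rightarrow> 'v"
  assumes "finite P" "\<And>n. x n \<in> gen P"
  obtains i j where "i < j" "x j \<in> (+) (x i) ` gen P" "s (x i) \<le> s (x j)"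
proof -
  obtain \<phi> :: "nat \<Rightarrow> nat" where \<phi>: "strict_mono \<phi>" "\<And>i j. i < j \<Longrightarrow> x (\<phi> j) \<in> (+) (x (\<phi> i)) ` gen P"
    using gen_subseq[of P x] assms by blast
  obtain \<psi> :: "nat \<Rightarrow> nat" where \<psi>: "strict_mono \<psi>" "\<And>i j. i < j \<Longrightarrow> s (x (\<phi> (\<psi> i))) \<le> s (x (\<phi> (\<psi> j)))"
    using mono_subseq_nat[of "\<lambda>n. s (x (\<phi> n))"] by blast
  have "\<psi> 0 < \<psi> 1" using \<psi>(1) by (simp add: strict_mono_less)
  moreover from this have "\<phi> (\<psi> 0) < \<phi> (\<psi> 1)" using \<phi>(1) by (simp add: strict_mono_less)
  ultimately show thesis using that[of "\<phi> (\<psi> 0)" "\<phi> (\<psi> 1)"] \<phi>(2) \<psi>(2)[of 0 1] by auto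
qed

section \<open>Finite covers and finite generation\<close>

text \<open>Each term is chosen by course-of-values recursion against the finite set of its
  predecessors. This turns the failure of all finite candidate sets into an infinite sequence, to
  which \<open>gen_good_pair\<close> applies.\<close>

lemma sequence_of_finite_escape:
  assumes "\<And>M. finite M \<Longrightarrow> M \<subseteq> K \<Longrightarrow> \<exists>y\<in>K. R M y"
  shows "\<exists>x::nat \<Rightarrow> 'a. \<forall>n. x n \<in> K \<and> R (x ` {..<n}) (x n)"
proof (rule dependent_wellorder_choice)
  fix r and f g :: "nat \<Rightarrow> 'a" and n :: nat
  assume "\<And>i. i < n \<Longrightarrow> f i = g i"
  then have "f ` {..<n} = g ` {..<n}" by auto
  then show "(r \<in> K \<and> R (f ` {..<n}) r) = (r \<in> K \<and> R (g ` {..<n}) r)" by simp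
next
  fix n :: nat and f
  assume "\<And>y. y < n \<Longrightarrow> f y \<in> K \<and> R (f ` {..<y}) (f y)"
  then show "\<exists>r. r \<in> K \<and> R (f ` {..<n}) r" using assms[of "f ` {..<n}"] by auto
qed

text \<open>
  The measure \<open>s\<close> plays the role of a slack variable: it turns an inequality into an equation, whose
  solution sets are closed under differences.
\<close>

lemma finite_cover:
  fixes s :: "'v::comm_monoid_add \<Rightarrow> nat"
  assumes "finite P" "K \<subseteq> gen P"
    and diff: "\<And>x y. x \<in> K \<Longrightarrow> y \<in> K \<Longrightarrow> y \<in> (+) x ` gen P \<Longrightarrow> s x \<le> s y \<Longrightarrow> y \<in> (+) x ` H"
  obtains M where "finite M" "M \<subseteq> K" "K \<subseteq> (\<Union>x\<in>M. (+) x ` H)"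
proof (rule ccontr)
  assume no: "\<not> thesis"
  note cover = that
  \<comment> \<open>If no finite set covers \<open>K\<close>, there is a sequence in which no term
    is covered by an earlier one; a good pair refutes this.\<close>
  have "\<exists>y\<in>K. y \<notin> (\<Union>x\<in>M. (+) x ` H)" if M: "finite M" "M \<subseteq> K" for M
  proof (rule ccontr)
    assume "\<not> ?thesis"
    then have "K \<subseteq> (\<Union>x\<in>M. (+) x ` H)" by (simp add: subset_iff)
    with no cover M show False by simp
  qed
  from sequence_of_finite_escape[of K "\<lambda>M y. y \<notin> (\<Union>x\<in>M. (+) x ` H)", OF this]
  obtain x :: "nat \<Rightarrow> 'v" where "\<forall>n. x n \<in> K \<and> x n \<notin> (\<Union>z\<in>x ` {..<n}. (+) z ` H)" ..
  then have x: "x n \<in> K" "x n \<notin> (\<Union>z\<in>x ` {..<n}. (+) z ` H)" for n by simp_all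
  obtain i j where "i < j" "x j \<in> (+) (x i) ` gen P" "s (x i) \<le> s (x j)"
    using gen_good_pair[of P x s] assms(1,2) x(1) by blast
  then have "x j \<in> (+) (x i) ` H" using diff[of "x i" "x j"] x(1) by simp
  then show False using x(2)[of j] \<open>i < j\<close> by blast
qed

text \<open>Otherwise there is a sequence of elements of least size among those not generated by
  their predecessors. In a good pair \<open>x j = x i + u\<close> the summand \<open>u\<close> is
  smaller than \<open>x j\<close>, hence generated by the predecessors, and then so is
  \<open>x j\<close>.\<close>

lemma finitely_generated:
  fixes s :: "'b multiset \<Rightarrow> nat"
  assumes "finite P" "K \<subseteq> gen P" and K: "0 \<in> K" "\<And>x y. x \<in> K \<Longrightarrow> y \<in> K \<Longrightarrow> x + y \<in> K"
    and diff: "\<And>x y. x \<in> K \<Longrightarrow> y \<in> K \<Longrightarrow> y \<in> (+) x ` gen P \<Longrightarrow> s x \<le> s y \<Longrightarrow> y \<in> (+) x ` K"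
  obtains G where "finite G" "K = gen G"
proof (rule ccontr)
  assume "\<not> thesis"
  with that have no: "\<not> K \<subseteq> gen M" if "finite M" "M \<subseteq> K" for M
    using \<open>finite M\<close> \<open>M \<subseteq> K\<close> gen_least[of M K] K by blast
  have "\<exists>y\<in>K. y \<notin> gen M \<and> (\<forall>z\<in>K. size z < size y \<longrightarrow> z \<in> gen M)" if "finite M" "M \<subseteq> K" for M
  proof -
    from no[OF that] obtain y where "y \<in> K \<and> y \<notin> gen M" by blast
    from ex_has_least_nat[of "\<lambda>y. y \<in> K \<and> y \<notin> gen M", OF this, of size]
    show ?thesis by (meson not_le)
  qed
  from sequence_of_finite_escape[of K "\<lambda>M y. y \<notin> gen M \<and> (\<forall>z\<in>K. size z < size y \<longrightarrow> z \<in> gen M)", OF this]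
  obtain x :: "nat \<Rightarrow> 'b multiset" where "\<forall>n. x n \<in> K \<and> x n \<notin> gen (x ` {..<n}) \<and>
    (\<forall>z\<in>K. size z < size (x n) \<longrightarrow> z \<in> gen (x ` {..<n}))" ..
  then have x: "x n \<in> K" "x n \<notin> gen (x ` {..<n})"
    "z \<in> K \<Longrightarrow> size z < size (x n) \<Longrightarrow> z \<in> gen (x ` {..<n})" for n z by simp_all
  obtain i j where ij: "i < j" "x j \<in> (+) (x i) ` gen P" "s (x i) \<le> s (x j)"
    using gen_good_pair[of P x s] assms(1,2) x(1) by blast
  then obtain u where u: "u \<in> K" "x j = x i + u" using diff[of "x i" "x j"] x by blast
  \<comment> \<open>\<open>0\<close> lies in every \<open>gen\<close>, whereas \<open>x i\<close> is
    not generated by its predecessors.\<close>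
  have "x i \<noteq> 0" using x(2)[of i] by auto
  then have "size u < size (x j)" by (simp add: u(2) nonempty_has_size flip: empty_neutral)
  then have "u \<in> gen (x ` {..<j})" using x(3) u by blast
  moreover have "x i \<in> gen (x ` {..<j})" using ij by (auto intro: gen_base)
  ultimately show False using x(2)[of j] u gen_add by metis
qed

section \<open>Semilinear sets and their restriction by predicates\<close>

text \<open>A coordinate-free counterpart of \<open>semilinear_set\<close>: the coefficients of the
  periods are absorbed into \<open>gen\<close>.\<close>

definition semilin :: "'v::comm_monoid_add set \<Rightarrow> bool" where
  "semilin S \<longleftrightarrow> (\<exists>\<P>. finite \<P> \<and> (\<forall>(b, P)\<in>\<P>. finite P) \<and> S = (\<Union>(b, P)\<in>\<P>. (+) b ` gen P))"

lemma semilin_linear: "finite P \<Longrightarrow> semilin ((+) b ` gen P)"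
  unfolding semilin_def by (intro exI[of _ "{(b, P)}"]) simp

lemma semilin_empty: "semilin {}"
  unfolding semilin_def by (intro exI[of _ "{}"]) simp

lemma semilin_Un:
  assumes "semilin S" "semilin T"
  shows "semilin (S \<union> T)"
proof -
  from assms obtain \<P> \<Q> where
    "finite \<P>" "\<forall>(b, P)\<in>\<P>. finite P" "S = (\<Union>(b, P)\<in>\<P>. (+) b ` gen P)"
    "finite \<Q>" "\<forall>(b, P)\<in>\<Q>. finite P" "T = (\<Union>(b, P)\<in>\<Q>. (+) b ` gen P)"
    unfolding semilin_def by blast
  then show ?thesis unfolding semilin_def by (intro exI[of _ "\<P> \<union> \<Q>"]) auto
qed

lemma semilin_UN: "finite I \<Longrightarrow> (\<And>i. i \<in> I \<Longrightarrow> semilin (S i)) \<Longrightarrow> semilin (\<Union>i\<in>I. S i)"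
  by (induction rule: finite_induct) (auto intro: semilin_empty semilin_Un)

text \<open>Restricting arbitrary semilinear sets makes conjunction a matter of filtering twice.
  There is no closure rule for negation, so atoms are treated together with their negations.\<close>

definition filterable :: "('b multiset \<Rightarrow> bool) \<Rightarrow> bool" where
  "filterable Q \<longleftrightarrow> (\<forall>S. semilin S \<longrightarrow> semilin {x \<in> S. Q x})"

lemma filterable_linearI:
  assumes "\<And>b P. finite P \<Longrightarrow> semilin {x \<in> (+) b ` gen P. Q x}"
  shows "filterable Q"
  unfolding filterable_def
proof (intro allI impI)
  fix S :: "'a multiset set" assume "semilin S"
  then obtain \<P> where P: "finite \<P>" "\<forall>(b, P)\<in>\<P>. finite P" "S = (\<Union>(b, P)\<in>\<P>. (+) b ` gen P)"
    unfolding semilin_def by blast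
  have "{x \<in> S. Q x} = (\<Union>i\<in>\<P>. {x \<in> (+) (fst i) ` gen (snd i). Q x})"
    unfolding P(3) by (auto simp: case_prod_beta)
  also have "semilin \<dots>" using P(1,2) assms by (intro semilin_UN) auto
  finally show "semilin {x \<in> S. Q x}" .
qed

lemma filterable_const: "filterable (\<lambda>_. q)"
  by (cases q) (auto simp: filterable_def semilin_empty)

lemma filterable_conj: "filterable Q \<Longrightarrow> filterable R \<Longrightarrow> filterable (\<lambda>x. Q x \<and> R x)"
  unfolding filterable_def
proof (intro allI impI)
  fix S :: "'a multiset set"
  assume "\<forall>S. semilin S \<longrightarrow> semilin {x \<in> S. Q x}" "\<forall>S. semilin S \<longrightarrow> semilin {x \<in> S. R x}" "semilin S"
  then have "semilin {x \<in> {x \<in> S. Q x}. R x}" by blast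
  moreover have "{x \<in> {x \<in> S. Q x}. R x} = {x \<in> S. Q x \<and> R x}" by blast
  ultimately show "semilin {x \<in> S. Q x \<and> R x}" by simp
qed

lemma filterable_disj: "filterable Q \<Longrightarrow> filterable R \<Longrightarrow> filterable (\<lambda>x. Q x \<or> R x)"
  unfolding filterable_def
proof (intro allI impI)
  fix S :: "'a multiset set"
  assume "\<forall>S. semilin S \<longrightarrow> semilin {x \<in> S. Q x}" "\<forall>S. semilin S \<longrightarrow> semilin {x \<in> S. R x}" "semilin S"
  then have "semilin ({x \<in> S. Q x} \<union> {x \<in> S. R x})" by (intro semilin_Un) blast+
  moreover have "{x \<in> S. Q x} \<union> {x \<in> S. R x} = {x \<in> S. Q x \<or> R x}" by blast
  ultimately show "semilin {x \<in> S. Q x \<or> R x}" by simp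
qed

lemma filterable_bex: "finite I \<Longrightarrow> (\<And>i. i \<in> I \<Longrightarrow> filterable (Q i)) \<Longrightarrow> filterable (\<lambda>x. \<exists>i\<in>I. Q i x)"
  by (induction rule: finite_induct) (auto intro: filterable_disj filterable_const)

text \<open>\<open>R\<close> is the homogeneous version of \<open>Q\<close>. Its solutions in
  \<open>gen P\<close> form a finitely generated monoid, and finitely many translates of it cover
  the solutions of \<open>Q\<close> in \<open>b + gen P\<close>. The measures \<open>s\<close> and
  \<open>t\<close> ensure that the difference of two solutions is homogeneous.\<close>

lemma filterableI:
  fixes s :: "'b multiset \<Rightarrow> 'b multiset \<Rightarrow> nat" and t :: "'b multiset \<Rightarrow> nat"
  assumes K0: "R 0" "\<And>x y. R x \<Longrightarrow> R y \<Longrightarrow> R (x + y)"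
    and stable: "\<And>x y. Q x \<Longrightarrow> R y \<Longrightarrow> Q (x + y)"
    and diff: "\<And>b x y. Q (b + x) \<Longrightarrow> Q (b + (x + y)) \<Longrightarrow> s b x \<le> s b (x + y) \<Longrightarrow> R y"
    and diff0: "\<And>x y. R x \<Longrightarrow> R (x + y) \<Longrightarrow> t x \<le> t (x + y) \<Longrightarrow> R y"
  shows "filterable Q"
proof (rule filterable_linearI)
  fix b and P :: "'b multiset set" assume P: "finite P"
  let ?K = "{x \<in> gen P. Q (b + x)}" and ?H = "{x \<in> gen P. R x}"
  have diffs: "y \<in> (+) x ` ?H" if "x \<in> ?H" "y \<in> ?H" "y \<in> (+) x ` gen P" "t x \<le> t y" for x y
  proof -
    from that(3) obtain u where "u \<in> gen P" "y = x + u" ..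
    with that diff0[of x u] show ?thesis by simp
  qed
  have "?H \<subseteq> gen P" "0 \<in> ?H" "\<And>x y. x \<in> ?H \<Longrightarrow> y \<in> ?H \<Longrightarrow> x + y \<in> ?H"
    using K0 gen_add by auto
  then obtain G where G: "finite G" "?H = gen G"
    using diffs by (rule finitely_generated[OF P])
  have cover: "y \<in> (+) x ` ?H" if "x \<in> ?K" "y \<in> ?K" "y \<in> (+) x ` gen P" "s b x \<le> s b y" for x y
  proof -
    from that(3) obtain u where "u \<in> gen P" "y = x + u" ..
    with that diff[of b x u] show ?thesis by simp
  qed
  have "?K \<subseteq> gen P" by blast
  then obtain M where M: "finite M" "M \<subseteq> ?K" "?K \<subseteq> (\<Union>x\<in>M. (+) x ` ?H)"
    using cover by (rule finite_cover[OF P])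
  have "{x \<in> (+) b ` gen P. Q x} = (\<Union>m\<in>M. (+) (b + m) ` ?H)"
  proof (intro equalityI subsetI)
    fix x assume "x \<in> {x \<in> (+) b ` gen P. Q x}"
    then obtain y where "y \<in> ?K" "x = b + y" by blast
    with M(3) show "x \<in> (\<Union>m\<in>M. (+) (b + m) ` ?H)" by (force simp: add.assoc)
  next
    fix x assume "x \<in> (\<Union>m\<in>M. (+) (b + m) ` ?H)"
    then obtain m y where my: "m \<in> M" "y \<in> ?H" "x = b + m + y" by blast
    then have "x = b + (m + y)" "m \<in> gen P" "Q (b + m)" using M(2) by (auto simp: add.assoc)
    moreover have "m + y \<in> gen P" using my(2) \<open>m \<in> gen P\<close> gen_add by blast
    moreover have "Q x" using my(2,3) \<open>Q (b + m)\<close> stable by simp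
    ultimately show "x \<in> {x \<in> (+) b ` gen P. Q x}" by blast
  qed
  also have "semilin \<dots>" unfolding G(2) by (intro semilin_UN M(1) semilin_linear G(1))
  finally show "semilin {x \<in> (+) b ` gen P. Q x}" .
qed

section \<open>Affine inequalities and divisibilities\<close>

text \<open>Equivalently, \<open>f - f 0\<close> is additive.\<close>

definition affine :: "('v::comm_monoid_add \<Rightarrow> int) \<Rightarrow> bool" where
  "affine f \<longleftrightarrow> (\<forall>x y. f (x + y) + f 0 = f x + f y)"

lemma affine_add: "affine f \<Longrightarrow> affine g \<Longrightarrow> affine (\<lambda>x. f x + g x)"
  unfolding affine_def by (metis (no_types, lifting) add.assoc add.commute)

lemma affine_mult: "affine f \<Longrightarrow> affine (\<lambda>x. c * f x)"
  by (simp add: affine_def flip: distrib_left)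

lemma affine_uminus: "affine f \<Longrightarrow> affine (\<lambda>x. - f x)"
  using affine_mult[of f "-1"] by simp

lemma affine_diff: "affine f \<Longrightarrow> affine g \<Longrightarrow> affine (\<lambda>x. f x - g x)"
  using affine_add[OF _ affine_uminus, of f g] by simp

lemma affine_const: "affine (\<lambda>_. c)"
  by (simp add: affine_def)

lemma affine_count: "affine (\<lambda>x. int (count x i))"
  by (simp add: affine_def)

text \<open>The measures are the slacks of the two inequalities, which are nonnegative on solutions,
  so that \<open>nat\<close> loses nothing. If adding \<open>y\<close> does not shrink the slack,
  the increment \<open>f y - f 0\<close> is at most 0.\<close>

lemma filterable_le:
  assumes "affine f"
  shows "filterable (\<lambda>x. f x \<le> 0)"
proof -
  have f: "f (x + y) = f x + f y - f 0" for x y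
    using assms by (simp add: affine_def eq_diff_eq)
  show ?thesis
    by (rule filterableI[where R = "\<lambda>x. f x \<le> f 0" and s = "\<lambda>b x. nat (- f (b + x))"
          and t = "\<lambda>x. nat (f 0 - f x)"]) (auto simp: f)
qed

text \<open>The homogeneous congruence is closed under differences, so constant measures
  suffice.\<close>

lemma filterable_dvd:
  assumes "affine f"
  shows "filterable (\<lambda>x. m dvd f x)"
proof -
  have f: "f (x + y) = f x + (f y - f 0)" for x y
    using assms by (simp add: affine_def eq_diff_eq algebra_simps)
  have f3: "f (b + (x + y)) = f (b + x) + (f y - f 0)" for b x y
    by (simp add: f flip: add.assoc)
  have iff: "m dvd f x + (f y - f 0) \<longleftrightarrow> m dvd f y - f 0" if "m dvd f x" for x y
    using that by (rule dvd_add_right_iff)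
  have iff0: "m dvd f (x + y) - f 0 \<longleftrightarrow> m dvd f y - f 0" if "m dvd f x - f 0" for x y
    using dvd_add_right_iff[OF that, of "f y - f 0"] by (simp add: f algebra_simps)
  show ?thesis
    by (rule filterableI[where R = "\<lambda>x. m dvd f x - f 0" and s = "\<lambda>_ _. 0" and t = "\<lambda>_. 0"])
      (simp_all add: iff0 f3 iff, simp add: f iff)
qed

text \<open>The nonzero residues modulo \<open>m\<close> give a finite disjunction of
  divisibilities. For \<open>m = 0\<close> the claim is that \<open>f x\<close> is nonzero, a
  disjunction of two inequalities.\<close>

lemma filterable_not_dvd:
  assumes "affine f"
  shows "filterable (\<lambda>x. \<not> m dvd f x)"
proof (cases "m = 0")
  case True
  have "(\<not> m dvd f x) \<longleftrightarrow> f x + 1 \<le> 0 \<or> - f x + 1 \<le> 0" for x using True by auto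
  then show ?thesis
    using assms by (simp only:) (intro filterable_disj filterable_le affine_add affine_uminus affine_const)
next
  case False
  have "(\<not> m dvd f x) \<longleftrightarrow> (\<exists>r\<in>{1..<\<bar>m\<bar>}. m dvd f x + - r)" for x
  proof
    assume "\<not> m dvd f x"
    then have "f x mod \<bar>m\<bar> \<noteq> 0" by auto
    moreover have "0 \<le> f x mod \<bar>m\<bar>" "f x mod \<bar>m\<bar> < \<bar>m\<bar>" using False by auto
    moreover have "m dvd f x + - (f x mod \<bar>m\<bar>)" using minus_mod_eq_mult_div[of "f x" "\<bar>m\<bar>"] by simp
    ultimately show "\<exists>r\<in>{1..<\<bar>m\<bar>}. m dvd f x + - r" by (intro bexI[of _ "f x mod \<bar>m\<bar>"]) auto
  next
    assume "\<exists>r\<in>{1..<\<bar>m\<bar>}. m dvd f x + - r"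
    then obtain r where r: "r \<in> {1..<\<bar>m\<bar>}" "m dvd f x + - r" ..
    then have "\<not> m dvd r" using zdvd_not_zless[of r "\<bar>m\<bar>"] by simp
    with r(2) show "\<not> m dvd f x" using dvd_add_right_iff[of m "f x" "- r"] by auto
  qed
  then show ?thesis
    using assms by (simp only:) (intro filterable_bex filterable_dvd affine_add affine_const; simp)
qed

section \<open>Presburger-definable predicates\<close>

definition env :: "nat \<Rightarrow> (nat \<Rightarrow> nat) \<Rightarrow> int list" where
  "env N e = map (\<lambda>i. int (e i)) [0..<N]"

lemma env_Suc: "env (Suc N) (case_nat x e) = int x # env N e"
  unfolding env_def by (simp add: upt_conv_Cons map_Suc_upt[symmetric] del: upt_Suc)

text \<open>
  The formula has to work for all sufficiently long environments, since \<^const>\<open>Ifm\<close> gives no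
  meaning to variables beyond the end of the list.
\<close>

definition presb :: "((nat \<Rightarrow> nat) \<Rightarrow> bool) \<Rightarrow> bool" where
  "presb P \<longleftrightarrow> (\<exists>p M. \<forall>N\<ge>M. \<forall>e. P e \<longleftrightarrow> Ifm [] (env N e) p)"

lemma presbE:
  assumes "presb P"
  obtains p M where "\<And>N e. N \<ge> M \<Longrightarrow> P e \<longleftrightarrow> Ifm [] (env N e) p"
  using assms unfolding presb_def by blast

lemma presbI:
  assumes "\<And>N e. N \<ge> M \<Longrightarrow> P e \<longleftrightarrow> Ifm [] (env N e) p"
  shows "presb P"
  using assms unfolding presb_def by blast

lemma presb_const: "presb (\<lambda>_. q)"
  by (rule presbI[of 0 _ "if q then Cooper.T else Cooper.F"]) simp

lemma presb_not: "presb P \<Longrightarrow> presb (\<lambda>e. \<not> P e)"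
proof (elim presbE)
  fix p M assume "\<And>N e. N \<ge> M \<Longrightarrow> P e \<longleftrightarrow> Ifm [] (env N e) p"
  then show ?thesis by (intro presbI[of M _ "Not p"]) simp
qed

lemma presb_conj:
  assumes "presb P" "presb Q"
  shows "presb (\<lambda>e. P e \<and> Q e)"
proof -
  from assms obtain p M q K where "\<And>N e. N \<ge> M \<Longrightarrow> P e \<longleftrightarrow> Ifm [] (env N e) p"
    "\<And>N e. N \<ge> K \<Longrightarrow> Q e \<longleftrightarrow> Ifm [] (env N e) q"
    by (elim presbE) blast
  then show ?thesis by (intro presbI[of "max M K" _ "And p q"]) auto
qed

lemma presb_disj: "presb P \<Longrightarrow> presb Q \<Longrightarrow> presb (\<lambda>e. P e \<or> Q e)"
  using presb_not[OF presb_conj[OF presb_not presb_not]] by simp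

lemma presb_ball: "finite I \<Longrightarrow> (\<And>i. i \<in> I \<Longrightarrow> presb (P i)) \<Longrightarrow> presb (\<lambda>e. \<forall>i\<in>I. P i e)"
  by (induction rule: finite_induct) (auto intro: presb_conj presb_const)

lemma presb_bex: "finite I \<Longrightarrow> (\<And>i. i \<in> I \<Longrightarrow> presb (P i)) \<Longrightarrow> presb (\<lambda>e. \<exists>i\<in>I. P i e)"
  by (induction rule: finite_induct) (auto intro: presb_disj presb_const)

text \<open>Quantification in formulas is over the integers, so \<open>Ge (Bound 0)\<close>
  restricts it to the naturals; \<open>case_nat x e\<close> puts the new variable at index
  0.\<close>

lemma presb_ex:
  assumes "presb P"
  shows "presb (\<lambda>e. \<exists>x. P (case_nat x e))"
proof -
  from assms obtain p M where p: "\<And>N e. N \<ge> M \<Longrightarrow> P e \<longleftrightarrow> Ifm [] (env N e) p"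
    by (elim presbE) blast
  have "(\<exists>x. P (case_nat x e)) \<longleftrightarrow> (\<exists>z\<ge>0. Ifm [] (z # env N e) p)" if "N \<ge> M" for N e
  proof -
    have "P (case_nat x e) \<longleftrightarrow> Ifm [] (int x # env N e) p" for x
      using p[of "Suc N"] that by (simp add: env_Suc)
    then show ?thesis by (metis nonneg_int_cases of_nat_0_le_iff)
  qed
  then show ?thesis
    by (intro presbI[of M _ "Cooper.E (And (Ge (Bound 0)) p)"]) simp
qed

lemma presb_exs:
  assumes "presb P"
  shows "presb (\<lambda>e. \<exists>y. P (\<lambda>i. if i < k then y i else e (i - k)))"
  using assms
proof (induction k)
  case 0
  then show ?case by simp
next
  case (Suc k)
  \<comment> \<open>The last variable \<open>y k\<close> of the block is the one bound by the outer
    quantifier; the other \<open>k\<close> variables stand in front of it.\<close>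
  have shift: "(\<lambda>i. if i < Suc k then y i else e (i - Suc k)) =
      (\<lambda>i. if i < k then y i else case_nat (y k) e (i - k))" for y :: "nat \<Rightarrow> nat" and e
  proof
    fix i show "(if i < Suc k then y i else e (i - Suc k)) = (if i < k then y i else case_nat (y k) e (i - k))"
      by (cases i k rule: linorder_cases) (auto dest: less_imp_Suc_add)
  qed
  have "presb (\<lambda>e. \<exists>x. \<exists>y. P (\<lambda>i. if i < k then y i else case_nat x e (i - k)))"
    by (rule presb_ex[OF Suc.IH[OF Suc.prems]])
  moreover have "(\<exists>x y. P (\<lambda>i. if i < k then y i else case_nat x e (i - k)))
      \<longleftrightarrow> (\<exists>y. P (\<lambda>i. if i < Suc k then y i else e (i - Suc k)))" for e
  proof
    assume "\<exists>x y. P (\<lambda>i. if i < k then y i else case_nat x e (i - k))"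
    then obtain x y where "P (\<lambda>i. if i < k then y i else case_nat x e (i - k))" by blast
    moreover have "(\<lambda>i. if i < k then y i else case_nat x e (i - k)) =
        (\<lambda>i. if i < Suc k then (y(k := x)) i else e (i - Suc k))"
      unfolding shift by (simp add: fun_eq_iff split: nat.split)
    ultimately show "\<exists>y. P (\<lambda>i. if i < Suc k then y i else e (i - Suc k))" by metis
  next
    assume "\<exists>y. P (\<lambda>i. if i < Suc k then y i else e (i - Suc k))"
    then show "\<exists>x y. P (\<lambda>i. if i < k then y i else case_nat x e (i - k))"
      unfolding shift by blast
  qed
  ultimately show ?case by simp
qed

text \<open>The shortest admissible environment contains only the first \<open>M\<close>
  values.\<close>

lemma presb_finitely_determined:
  assumes "presb P"
  obtains M where "\<And>e e'. (\<And>i. i < M \<Longrightarrow> e i = e' i) \<Longrightarrow> P e \<longleftrightarrow> P e'"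
proof -
  from assms obtain p M where p: "\<And>N e. N \<ge> M \<Longrightarrow> P e \<longleftrightarrow> Ifm [] (env N e) p"
    by (elim presbE) blast
  have "P e \<longleftrightarrow> P e'" if "\<And>i. i < M \<Longrightarrow> e i = e' i" for e e'
  proof -
    have "env M e = env M e'" using that by (simp add: env_def)
    then show ?thesis by (simp add: p[of M])
  qed
  then show thesis by (rule that)
qed

section \<open>Linear terms and substitution of variables\<close>

definition lin :: "((nat \<Rightarrow> nat) \<Rightarrow> int) \<Rightarrow> bool" where
  "lin f \<longleftrightarrow> (\<exists>t M. \<forall>N\<ge>M. \<forall>e. f e = Inum (env N e) t)"

lemma lin_const: "lin (\<lambda>_. c)"
  unfolding lin_def by (rule exI[of _ "Cooper.C c"]) simp

lemma lin_var: "lin (\<lambda>e. int (e i))"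
  unfolding lin_def by (intro exI[of _ "Bound i"] exI[of _ "Suc i"]) (simp add: env_def)

lemma lin_mult: "lin f \<Longrightarrow> lin (\<lambda>e. c * f e)"
  unfolding lin_def
proof (elim exE)
  fix t M assume "\<forall>N\<ge>M. \<forall>e. f e = Inum (env N e) t"
  then show "\<exists>t M. \<forall>N\<ge>M. \<forall>e. c * f e = Inum (env N e) t"
    by (intro exI[of _ "Mul c t"] exI[of _ M]) simp
qed

lemma lin_add: "lin f \<Longrightarrow> lin g \<Longrightarrow> lin (\<lambda>e. f e + g e)"
  unfolding lin_def
proof (elim exE)
  fix t M u K assume "\<forall>N\<ge>M. \<forall>e. f e = Inum (env N e) t" "\<forall>N\<ge>K. \<forall>e. g e = Inum (env N e) u"
  then show "\<exists>t M. \<forall>N\<ge>M. \<forall>e. f e + g e = Inum (env N e) t"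
    by (intro exI[of _ "Add t u"] exI[of _ "max M K"]) auto
qed

lemma lin_sum: "(\<And>i. i \<in> I \<Longrightarrow> lin (f i)) \<Longrightarrow> lin (\<lambda>e. \<Sum>i\<in>I. f i e)"
  by (induction I rule: infinite_finite_induct) (auto intro: lin_const lin_add)

lemma presb_eq:
  assumes "lin f" "lin g"
  shows "presb (\<lambda>e. f e = g e)"
proof -
  obtain t M where "\<forall>N\<ge>M. \<forall>e. f e + -1 * g e = Inum (env N e) t"
    using lin_add[OF assms(1) lin_mult[OF assms(2), of "-1"]] unfolding lin_def by blast
  moreover have "f e = g e \<longleftrightarrow> f e + -1 * g e = 0" for e by linarith
  ultimately show ?thesis by (intro presbI[of M _ "Eq t"]) simp
qed

lemma presb_var_eq: "presb (\<lambda>e. e i = c)"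
  using presb_eq[OF lin_var lin_const, of i "int c"] by simp

text \<open>Only the first \<open>M\<close> arguments of \<open>P\<close> matter. They become a
  block of fresh variables equated with the values \<open>e (\<sigma> i)\<close>, whose indices the
  block shifts by \<open>M\<close>.\<close>

lemma presb_reindex:
  assumes "presb P"
  shows "presb (\<lambda>e. P (\<lambda>i. e (\<sigma> i)))"
proof -
  obtain M where M: "\<And>e e'. (\<And>i. i < M \<Longrightarrow> e i = e' i) \<Longrightarrow> P e \<longleftrightarrow> P e'"
    using presb_finitely_determined[OF assms] by blast
  define Q where "Q e \<longleftrightarrow> P e \<and> (\<forall>i\<in>{..<M}. int (e i) = int (e (\<sigma> i + M)))" for e :: "nat \<Rightarrow> nat"
  have "presb Q" unfolding Q_def
    by (intro presb_conj presb_ball assms presb_eq lin_var) simp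
  from presb_exs[OF this, of M] have "presb (\<lambda>e. \<exists>y. Q (\<lambda>i. if i < M then y i else e (i - M)))" .
  moreover have "(\<exists>y. Q (\<lambda>i. if i < M then y i else e (i - M))) \<longleftrightarrow> P (\<lambda>i. e (\<sigma> i))" for e
  proof
    assume "\<exists>y. Q (\<lambda>i. if i < M then y i else e (i - M))"
    then obtain y where "P (\<lambda>i. if i < M then y i else e (i - M))" "\<And>i. i < M \<Longrightarrow> y i = e (\<sigma> i)"
      by (auto simp: Q_def)
    then show "P (\<lambda>i. e (\<sigma> i))" using M[of "\<lambda>i. if i < M then y i else e (i - M)" "\<lambda>i. e (\<sigma> i)"] by simp
  next
    assume "P (\<lambda>i. e (\<sigma> i))"
    moreover have "P (\<lambda>i. if i < M then e (\<sigma> i) else e (i - M)) \<longleftrightarrow> P (\<lambda>i. e (\<sigma> i))"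
      by (rule M) simp
    ultimately have "Q (\<lambda>i. if i < M then e (\<sigma> i) else e (i - M))" by (simp add: Q_def)
    then show "\<exists>y. Q (\<lambda>i. if i < M then y i else e (i - M))" by (rule exI[where x = "\<lambda>i. e (\<sigma> i)"])
  qed
  ultimately show ?thesis by simp
qed

section \<open>Quantifier-free formulas and quantifier elimination\<close>

lemma affine_Inum: "affine (\<lambda>x. Inum (env N (count x)) t)"
proof -
  have var: "affine (\<lambda>x. env N (count x) ! n)" for n
  proof (cases "n < N")
    case True
    then show ?thesis by (simp add: env_def affine_count)
  next
    case False
    \<comment> \<open>Beyond the end of the list the value is unspecified, but it does not depend on
      \<open>x\<close>.\<close>
    then have "env N (count x) ! n = [] ! (n - N)" for x
      using nth_append[of "env N (count x)" "[]" n] by (simp add: env_def)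
    then show ?thesis by (simp add: affine_const)
  qed
  show ?thesis
    by (induction t) (simp_all add: var affine_add affine_mult affine_uminus affine_diff affine_const)
qed

lemma filterable_imp: "filterable (\<lambda>x. \<not> Q x) \<Longrightarrow> filterable R \<Longrightarrow> filterable (\<lambda>x. Q x \<longrightarrow> R x)"
  unfolding imp_conv_disj by (rule filterable_disj)

text \<open>Both polarities are proved together, because \<open>filterable\<close> cannot be negated
  and negations may stand above any subformula.\<close>

lemma filterable_qfree:
  assumes "qfree p"
  shows "filterable (\<lambda>x. Ifm [] (env N (count x)) p) \<and> filterable (\<lambda>x. \<not> Ifm [] (env N (count x)) p)"
  using assms
proof (induction p)
  note rules = filterable_le affine_Inum affine_add affine_uminus affine_const
  have le: "filterable (\<lambda>x. Inum (env N (count x)) t \<le> 0)" for t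
    by (intro rules)
  have ge: "filterable (\<lambda>x. 0 \<le> Inum (env N (count x)) t)" for t
    using filterable_le[OF affine_uminus[OF affine_Inum[of N t]]] by simp
  \<comment> \<open>Over the integers a strict inequality is a weak one shifted by 1.\<close>
  have gt: "filterable (\<lambda>x. 0 < Inum (env N (count x)) t)" for t
    using filterable_le[OF affine_add[OF affine_uminus[OF affine_Inum[of N t]] affine_const[of 1]]]
    by (simp add: int_one_le_iff_zero_less)
  have lt: "filterable (\<lambda>x. Inum (env N (count x)) t < 0)" for t
    using filterable_le[OF affine_add[OF affine_Inum[of N t] affine_const[of 1]]]
    by (simp add: add1_zle_eq)
  have eq: "filterable (\<lambda>x. Inum (env N (count x)) t = 0)" for t
    using filterable_conj[OF le[of t] ge[of t]] by (simp add: eq_iff)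
  have neq: "filterable (\<lambda>x. Inum (env N (count x)) t \<noteq> 0)" for t
    using filterable_disj[OF lt[of t] gt[of t]] by (simp add: neq_iff)
  { case (Lt t) show ?case using lt ge by (simp add: not_less) }
  { case (Le t) show ?case using le gt by (simp add: not_le) }
  { case (Gt t) show ?case using gt le by (simp add: not_less) }
  { case (Ge t) show ?case using ge lt by (simp add: not_le) }
  { case (Eq t) show ?case using eq neq by simp }
  { case (NEq t) show ?case using eq neq by simp }
  { case (Dvd m t) show ?case by (simp add: filterable_dvd filterable_not_dvd affine_Inum) }
  { case (NDvd m t) show ?case by (simp add: filterable_dvd filterable_not_dvd affine_Inum) }
  { case (And p q) then show ?case by (simp add: filterable_imp filterable_conj filterable_disj) }
  { case (Or p q) then show ?case by (simp add: filterable_imp filterable_conj filterable_disj) }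
  { case (Imp p q) then show ?case by (simp add: filterable_imp filterable_conj filterable_disj) }
  { case (Iff p q)
    let ?p = "\<lambda>x. Ifm [] (env N (count x)) p" and ?q = "\<lambda>x. Ifm [] (env N (count x)) q"
    have "filterable (\<lambda>x. ?p x \<and> ?q x \<or> \<not> ?p x \<and> \<not> ?q x)"
      "filterable (\<lambda>x. ?p x \<and> \<not> ?q x \<or> \<not> ?p x \<and> ?q x)"
      using Iff by (intro filterable_conj filterable_disj; simp)+
    moreover have "(\<lambda>x. ?p x \<and> ?q x \<or> \<not> ?p x \<and> \<not> ?q x) = (\<lambda>x. ?p x = ?q x)"
      "(\<lambda>x. ?p x \<and> \<not> ?q x \<or> \<not> ?p x \<and> ?q x) = (\<lambda>x. \<not> (?p x = ?q x))"
      by auto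
    ultimately show ?case by simp }
qed (simp_all add: filterable_const)

text \<open>Multisets serve as vectors of naturals and singletons as unit vectors, so this exhibits
  the whole space as a linear set.\<close>

lemma gen_singletons: "gen ((\<lambda>i. {#i#}) ` I) = {x. set_mset x \<subseteq> I}"
proof
  show "gen ((\<lambda>i. {#i#}) ` I) \<subseteq> {x. set_mset x \<subseteq> I}" by (rule gen_least) auto
  have "x \<in> gen ((\<lambda>i. {#i#}) ` I)" if "set_mset x \<subseteq> I" for x
    using that
  proof (induction x)
    case (add i x)
    then have "{#i#} + x \<in> gen ((\<lambda>i. {#i#}) ` I)" by (intro gen_step) auto
    then show ?case by simp
  qed (use gen_zero in simp)
  then show "{x. set_mset x \<subseteq> I} \<subseteq> gen ((\<lambda>i. {#i#}) ` I)" by blast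
qed

text \<open>At the fixed environment length \<open>M\<close>, the elimination procedure
  \<open>pa\<close>, correct by \<open>mirqe\<close>, yields an equivalent quantifier-free formula,
  which is then used to filter the whole space.\<close>

theorem semilin_presb:
  assumes "presb P"
  shows "semilin {x :: nat multiset. set_mset x \<subseteq> {..<d} \<and> P (count x)}"
proof -
  from assms obtain p M where p: "\<And>N e. N \<ge> M \<Longrightarrow> P e \<longleftrightarrow> Ifm [] (env N e) p"
    by (elim presbE) blast
  have "semilin ((+) 0 ` gen ((\<lambda>i. {#i#}) ` {..<d}))" by (rule semilin_linear) simp
  then have "semilin {x. set_mset x \<subseteq> {..<d}}" by (simp add: gen_singletons)
  moreover have "filterable (\<lambda>x. P (count x))"
    using filterable_qfree[of "pa p" M] mirqe[of "[]" _ p] by (simp add: p[of M])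
  ultimately show ?thesis by (auto simp: filterable_def)
qed

section \<open>Semilinear sets with infinite components\<close>

text \<open>Separates the pattern \<open>J\<close> of infinite components from the finite values,
  which form an environment. For fixed \<open>J\<close>, membership in a set thus becomes a
  predicate for \<open>presb\<close>.\<close>

definition vec :: "nat \<Rightarrow> nat set \<Rightarrow> (nat \<Rightarrow> nat) \<Rightarrow> enat list" where
  "vec d J e = map (\<lambda>i. if i \<in> J then \<infinity> else enat (e i)) [0..<d]"

lemma length_vec [simp]: "length (vec d J e) = d"
  by (simp add: vec_def)

lemma nth_vec [simp]: "i < d \<Longrightarrow> vec d J e ! i = (if i \<in> J then \<infinity> else enat (e i))"
  by (simp add: vec_def)

lemma vec_cases:
  assumes "length v = d"
  obtains J x where "J \<subseteq> {..<d}" "set_mset x \<subseteq> {..<d}" "v = vec d J (count x)"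
proof -
  \<comment> \<open>The unspecified value of \<open>the_enat\<close> at \<open>\<infinity>\<close>
    is harmless, as \<open>vec\<close> overrides those components.\<close>
  let ?x = "\<Sum>i<d. replicate_mset (the_enat (v ! i)) i"
  have "count ?x i = the_enat (v ! i)" if "i < d" for i
    using that by (simp add: count_sum)
  then have "v = vec d {i \<in> {..<d}. v ! i = \<infinity>} (count ?x)"
    using assms by (intro nth_equalityI) auto
  moreover have "set_mset ?x \<subseteq> {..<d}" by (auto simp: set_mset_sum split: if_splits)
  ultimately show thesis by (intro that) auto
qed

text \<open>By \<open>vec_cases\<close> the predicates for all \<open>J\<close> determine
  \<open>X\<close>. Boolean operations on sets become connectives, which is how closure under
  complement is obtained.\<close>

definition definable :: "nat \<Rightarrow> enat list set \<Rightarrow> bool" where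
  "definable d X \<longleftrightarrow> X \<subseteq> {v. length v = d} \<and> (\<forall>J. presb (\<lambda>e. vec d J e \<in> X))"

lemma definable_compl: "definable d X \<Longrightarrow> definable d {v. length v = d \<and> v \<notin> X}"
  by (auto simp: definable_def intro: presb_not)

lemma definable_Int: "definable d X \<Longrightarrow> definable d Y \<Longrightarrow> definable d (X \<inter> Y)"
  by (auto simp: definable_def intro: presb_conj)

lemma definable_Un: "definable d X \<Longrightarrow> definable d Y \<Longrightarrow> definable d (X \<union> Y)"
  by (auto simp: definable_def intro: presb_disj)

lemma definable_UN: "finite I \<Longrightarrow> (\<And>i. i \<in> I \<Longrightarrow> definable d (X i)) \<Longrightarrow> definable d (\<Union>i\<in>I. X i)"
  unfolding definable_def UN_iff by (intro conjI allI presb_bex) auto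

text \<open>For a fixed pattern the condition reads \<open>j \<in> J\<close>, independently of
  \<open>e\<close>.\<close>

lemma definable_infinite: "j < d \<Longrightarrow> definable d {v. length v = d \<and> v ! j = \<infinity>}"
  by (auto simp: definable_def presb_const)

text \<open>The infinite components of the selected vector are the preimage of \<open>J\<close>
  under \<open>\<sigma>\<close>. This serves to read the counters of one factor off a vector of the
  product automaton.\<close>

lemma definable_reindex:
  assumes "definable c X" "\<And>i. i < c \<Longrightarrow> \<sigma> i < d"
  shows "definable d {v. length v = d \<and> map (\<lambda>i. v ! \<sigma> i) [0..<c] \<in> X}"
proof -
  have "map (\<lambda>i. vec d J e ! \<sigma> i) [0..<c] = vec c {i. \<sigma> i \<in> J} (\<lambda>i. e (\<sigma> i))" for J e
    using assms(2) by (auto simp: vec_def[of c])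
  then show ?thesis
    using assms(1) by (auto simp: definable_def intro: presb_reindex)
qed

section \<open>From linear sets to definable sets\<close>

lemma sum_eq_infinity_iff:
  fixes f :: "'b \<Rightarrow> enat"
  assumes "finite P"
  shows "(\<Sum>p\<in>P. f p) = \<infinity> \<longleftrightarrow> (\<exists>p\<in>P. f p = \<infinity>)"
  using assms by (induction rule: finite_induct) (auto simp: plus_eq_infty_iff_enat)

lemma sum_enat: "(\<Sum>p\<in>P. enat (f p)) = enat (\<Sum>p\<in>P. f p)"
  by (induction P rule: infinite_finite_induct) (auto simp: zero_enat_def)

text \<open>As \<open>\<infinity> * 0 = 0\<close>, the sum is infinite exactly if \<open>b\<close>
  is, or some infinite \<open>a p\<close> has a nonzero coefficient.\<close>

lemma presb_affine_infinite:
  assumes "finite P"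
  shows "presb (\<lambda>e. b + (\<Sum>p\<in>P. a p * enat (e (f p))) = \<infinity>)"
proof -
  have "presb (\<lambda>e. b = \<infinity> \<or> (\<exists>p\<in>P. a p = \<infinity> \<and> \<not> e (f p) = 0))"
    using assms by (intro presb_disj presb_bex presb_conj presb_not presb_const presb_var_eq)
  then show ?thesis
    by (simp add: plus_eq_infty_iff_enat sum_eq_infinity_iff[OF assms] imult_is_infinity enat_0_iff)
qed

text \<open>In a finite sum an infinite \<open>a p\<close> can only have coefficient 0, so the
  integer equation is correct whatever \<open>the_enat \<infinity>\<close> is.\<close>

lemma presb_affine_finite:
  assumes "finite P"
  shows "presb (\<lambda>e. b + (\<Sum>p\<in>P. a p * enat (e (f p))) = enat (e i))"
proof -
  let ?inf = "\<lambda>e. b + (\<Sum>p\<in>P. a p * enat (e (f p))) = \<infinity>"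
  let ?eq = "\<lambda>e. int (the_enat b) + (\<Sum>p\<in>P. int (the_enat (a p)) * int (e (f p))) = int (e i)"
  have "presb (\<lambda>e. \<not> ?inf e \<and> ?eq e)"
    using assms by (intro presb_conj presb_not presb_affine_infinite presb_eq lin_add lin_sum lin_mult lin_const lin_var)
  moreover have "\<not> ?inf e \<and> ?eq e \<longleftrightarrow> b + (\<Sum>p\<in>P. a p * enat (e (f p))) = enat (e i)" for e
  proof (cases "?inf e")
    case False
    then obtain b' where b: "b = enat b'" by (auto simp: plus_eq_infty_iff_enat)
    have "a p * enat (e (f p)) = enat (the_enat (a p) * e (f p))" if "p \<in> P" for p
    proof -
      from False that have "a p * enat (e (f p)) \<noteq> \<infinity>"
        by (auto simp: plus_eq_infty_iff_enat sum_eq_infinity_iff[OF assms])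
      then show ?thesis by (cases "a p") (auto simp: imult_is_infinity zero_enat_def split: if_splits)
    qed
    then have "b + (\<Sum>p\<in>P. a p * enat (e (f p))) = enat (b' + (\<Sum>p\<in>P. the_enat (a p) * e (f p)))"
      by (simp add: sum_enat b)
    moreover have "?eq e \<longleftrightarrow> int (b' + (\<Sum>p\<in>P. the_enat (a p) * e (f p))) = int (e i)" by (simp add: b)
    ultimately show ?thesis using False by (simp only: of_nat_eq_iff enat.inject) simp
  qed auto
  ultimately show ?thesis by simp
qed

text \<open>Membership asserts that suitable coefficients exist. They are quantified as a block of
  \<open>k\<close> variables, where \<open>f\<close> assigns to each period the index of its
  coefficient.\<close>

lemma definable_linear:
  assumes "linear_set d X"
  shows "definable d X"
proof -
  from assms obtain b P where P: "finite P" and X: "X = range (linear_comb d b P)"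
    unfolding linear_set_def by blast
  obtain f :: "enat list \<Rightarrow> nat" and k where f: "f ` P = {i. i < k}" "inj_on f P"
    using finite_imp_inj_to_nat_seg[OF P] by blast
  have "presb (\<lambda>e. vec d J e \<in> X)" for J
  proof -
    \<comment> \<open>Component \<open>j\<close> of the vector is variable \<open>j + k\<close>,
      behind the \<open>k\<close> coefficients.\<close>
    define Q where "Q e \<longleftrightarrow> (\<forall>j\<in>{..<d}. b ! j + (\<Sum>p\<in>P. p ! j * enat (e (f p)))
        = (if j \<in> J then \<infinity> else enat (e (j + k))))" for e
    have "presb (\<lambda>e. b ! j + (\<Sum>p\<in>P. p ! j * enat (e (f p))) = (if j \<in> J then \<infinity> else enat (e (j + k))))" for j
      using presb_affine_infinite[OF P] presb_affine_finite[OF P] by (cases "j \<in> J") auto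
    then have "presb Q" unfolding Q_def by (intro presb_ball) auto
    from presb_exs[OF this, of k] have "presb (\<lambda>e. \<exists>y. Q (\<lambda>i. if i < k then y i else e (i - k)))" .
    moreover have "(\<exists>y. Q (\<lambda>i. if i < k then y i else e (i - k))) \<longleftrightarrow> vec d J e \<in> X" for e
    proof -
      have fk: "f p < k" if "p \<in> P" for p using f(1) that by blast
      have Q: "Q (\<lambda>i. if i < k then y i else e (i - k)) \<longleftrightarrow> linear_comb d b P (\<lambda>p. y (f p)) = vec d J e" for y
        by (auto simp: Q_def list_eq_iff_nth_eq linear_comb_def fk cong: sum.cong)
      \<comment> \<open>As \<open>f\<close> is injective on \<open>P\<close>, every choice of
        coefficients comes from an assignment to the numbered variables.\<close>
      have inv: "linear_comb d b P z = linear_comb d b P (\<lambda>p. z (inv_into P f (f p)))" for z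
        using f(2) by (auto simp: linear_comb_def cong: sum.cong)
      have "(\<exists>y. linear_comb d b P (\<lambda>p. y (f p)) = v) \<longleftrightarrow> v \<in> range (linear_comb d b P)" for v
      proof
        assume "v \<in> range (linear_comb d b P)"
        then obtain z where "v = linear_comb d b P z" ..
        with inv[of z]
        show "\<exists>y. linear_comb d b P (\<lambda>p. y (f p)) = v"
          by (intro exI[of _ "\<lambda>i. z (inv_into P f i)"]) simp
      qed auto
      then show ?thesis by (simp only: Q X)
    qed
    ultimately show ?thesis by simp
  qed
  moreover have "X \<subseteq> {v. length v = d}" by (auto simp: X linear_comb_def)
  ultimately show ?thesis by (simp add: definable_def)
qed

section \<open>From definable sets to semilinear sets\<close>

lemma semilinear_UN:
  assumes "finite I" "\<And>i. i \<in> I \<Longrightarrow> semilinear_set d (X i)"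
  shows "semilinear_set d (\<Union>i\<in>I. X i)"
proof -
  from assms(2) obtain \<X> where "\<And>i. i \<in> I \<Longrightarrow> finite (\<X> i) \<and> (\<forall>Y\<in>\<X> i. linear_set d Y) \<and> X i = \<Union> (\<X> i)"
    unfolding semilinear_set_def by metis
  with assms(1) show ?thesis
    unfolding semilinear_set_def by (intro exI[of _ "\<Union>i\<in>I. \<X> i"]) auto
qed

text \<open>The base vector carries all infinite components, so finite periods suffice. Since
  \<open>q\<close> ignores elements from \<open>d\<close> on, several multisets in \<open>P\<close>
  may share one period.\<close>

lemma linear_vec:
  assumes P: "finite P"
  shows "linear_set d ((\<lambda>x. vec d J (count x)) ` (+) b ` gen P)"
proof -
  define q where "q p = map (\<lambda>i. enat (count p i)) [0..<d]" for p :: "nat multiset"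
  have q_nth: "q p ! j = enat (count p j)" if "j < d" for p j
    using that by (simp add: q_def)
  let ?sum = "\<lambda>F z j. \<Sum>p\<in>F. p ! j * enat (z p)"
  \<comment> \<open>Adding a generator \<open>p\<close> raises the coefficient of its period
    \<open>q p\<close> by one.\<close>
  have 1: "\<exists>z. \<forall>j<d. ?sum (q ` P) z j = enat (count x j)" if "x \<in> gen P" for x
    using that
  proof (induction rule: gen.induct)
    case gen_zero
    show ?case by (rule exI[of _ "\<lambda>_. 0"]) (simp flip: zero_enat_def)
  next
    case (gen_step p x)
    then obtain z where z: "\<And>j. j < d \<Longrightarrow> ?sum (q ` P) z j = enat (count x j)" by blast
    have split: "r ! j * enat ((z(q p := Suc (z (q p)))) r) = r ! j * enat (z r) + (if r = q p then q p ! j else 0)"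
      for r j
      by (cases "r = q p") (simp_all add: eSuc_enat[symmetric] mult_eSuc_right add.commute)
    have "?sum (q ` P) (z(q p := Suc (z (q p)))) j = enat (count (p + x) j)" if "j < d" for j
      unfolding split sum.distrib z[OF that] using P gen_step(1) that by (simp add: q_nth)
    then show ?case by blast
  qed
  \<comment> \<open>Conversely, one preimage in \<open>P\<close> is chosen for each period and
    repeated as often as its coefficient says.\<close>
  have 2: "\<exists>x\<in>gen P. \<forall>j<d. ?sum F z j = enat (count x j)" if "finite F" "F \<subseteq> q ` P" for F z
    using that
  proof (induction rule: finite_induct)
    case empty
    show ?case by (rule bexI[of _ 0]) (simp_all add: zero_enat_def)
  next
    case (insert r F)
    then obtain x p where x: "x \<in> gen P" "\<And>j. j < d \<Longrightarrow> ?sum F z j = enat (count x j)"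
      and p: "p \<in> P" "r = q p" by blast
    have "repeat_mset n p \<in> gen P" for n
      by (induction n) (use p gen_zero in \<open>auto intro: gen_step\<close>)
    with x(1) have "repeat_mset (z r) p + x \<in> gen P" by (blast intro: gen_add)
    moreover have "?sum (insert r F) z j = enat (count (repeat_mset (z r) p + x) j)" if "j < d" for j
      using insert.hyps x(2) that by (simp add: p(2) q_nth mult.commute)
    ultimately show ?case by blast
  qed
  have comb: "linear_comb d (vec d J (count b)) (q ` P) z = vec d J (count (b + x))"
    if "\<forall>j<d. ?sum (q ` P) z j = enat (count x j)" for z x
    using that by (auto simp: linear_comb_def intro!: nth_equalityI)
  have "(\<lambda>x. vec d J (count x)) ` (+) b ` gen P = range (linear_comb d (vec d J (count b)) (q ` P))"
  proof (intro equalityI subsetI)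
    fix v assume "v \<in> (\<lambda>x. vec d J (count x)) ` (+) b ` gen P"
    then obtain x where x: "x \<in> gen P" "v = vec d J (count (b + x))" by blast
    from 1[OF x(1)] obtain z where "\<forall>j<d. ?sum (q ` P) z j = enat (count x j)" ..
    from comb[OF this] show "v \<in> range (linear_comb d (vec d J (count b)) (q ` P))"
      unfolding x(2) by (metis rangeI)
  next
    fix v assume "v \<in> range (linear_comb d (vec d J (count b)) (q ` P))"
    then obtain z where v: "v = linear_comb d (vec d J (count b)) (q ` P) z" by blast
    obtain x where x: "x \<in> gen P" "\<forall>j<d. ?sum (q ` P) z j = enat (count x j)"
      using 2[of "q ` P" z] P by blast
    show "v \<in> (\<lambda>x. vec d J (count x)) ` (+) b ` gen P"
      unfolding v comb[OF x(2)] using x(1) by (intro imageI)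
  qed
  moreover have "\<forall>p\<in>q ` P. length p = d" by (simp add: q_def)
  ultimately show ?thesis using P unfolding linear_set_def by (metis finite_imageI length_vec)
qed

text \<open>For the converse direction, \<open>X\<close> splits into finitely many pieces, one for
  each pattern \<open>J\<close>; each is the image of a semilinear set of multisets.\<close>

theorem semilinear_set_iff_definable: "semilinear_set d X \<longleftrightarrow> definable d X"
proof
  assume "semilinear_set d X"
  then obtain \<X> where X: "finite \<X>" "\<And>Y. Y \<in> \<X> \<Longrightarrow> linear_set d Y" "X = \<Union> \<X>"
    unfolding semilinear_set_def by blast
  then have "definable d (\<Union>Y\<in>\<X>. Y)" by (intro definable_UN definable_linear)
  with X(3) show "definable d X" by simp
next
  assume X: "definable d X"
  let ?S = "\<lambda>J. {x. set_mset x \<subseteq> {..<d} \<and> vec d J (count x) \<in> X}"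
  have lin: "semilinear_set d ((\<lambda>x. vec d J (count x)) ` ?S J)" for J
  proof -
    have "presb (\<lambda>e. vec d J e \<in> X)" using X by (simp add: definable_def)
    from semilin_presb[OF this, of d] obtain \<P> where \<P>: "finite \<P>" "\<And>i. i \<in> \<P> \<Longrightarrow> finite (snd i)"
      "?S J = (\<Union>(b, P)\<in>\<P>. (+) b ` gen P)"
      unfolding semilin_def by (elim exE conjE) (auto simp: case_prod_beta)
    have "semilinear_set d ((\<lambda>x. vec d J (count x)) ` (+) (fst i) ` gen (snd i))" if "i \<in> \<P>" for i
      using linear_vec[OF \<P>(2)[OF that]] unfolding semilinear_set_def
      by (intro exI[of _ "{(\<lambda>x. vec d J (count x)) ` (+) (fst i) ` gen (snd i)}"]) simp
    then have "semilinear_set d (\<Union>i\<in>\<P>. (\<lambda>x. vec d J (count x)) ` (+) (fst i) ` gen (snd i))"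
      by (rule semilinear_UN[OF \<P>(1)])
    then show ?thesis unfolding \<P>(3) image_UN by (simp add: case_prod_beta)
  qed
  have "X = (\<Union>J\<in>Pow {..<d}. (\<lambda>x. vec d J (count x)) ` ?S J)"
  proof (intro equalityI subsetI)
    fix v assume v: "v \<in> X"
    with X have "length v = d" by (auto simp: definable_def)
    then obtain J x where "J \<subseteq> {..<d}" "set_mset x \<subseteq> {..<d}" "v = vec d J (count x)"
      by (rule vec_cases)
    with v show "v \<in> (\<Union>J\<in>Pow {..<d}. (\<lambda>x. vec d J (count x)) ` ?S J)" by blast
  qed blast
  also have "semilinear_set d \<dots>" by (intro semilinear_UN lin) simp
  finally show "semilinear_set d X" .
qed

section \<open>Runs of deterministic automata and their products\<close>

lemma weight_length: "limit_PA M \<Longrightarrow> t \<in> transitions M \<Longrightarrow> length (weight t) = dim M"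
  by (cases t) (auto simp: limit_PA_def)

lemma transition_letter: "limit_PA M \<Longrightarrow> t \<in> transitions M \<Longrightarrow> letter t \<in> alphabet M"
  by (cases t) (auto simp: limit_PA_def)

text \<open>Iterating the transition function \<open>\<delta>\<close> from the initial state gives a
  run, and induction on the position shows that every run agrees with it.\<close>

lemma deterministic_run:
  assumes M: "limit_PA M" "deterministic M" and \<alpha>: "\<alpha> \<in> omega_words (alphabet M)"
  shows "\<exists>!r. is_run M \<alpha> r"
proof -
  define \<delta> where "\<delta> p a = (THE t. t \<in> transitions M \<and> source t = p \<and> letter t = a)" for p a
  have \<alpha>': "\<alpha> i \<in> alphabet M" for i using \<alpha> by (auto simp: omega_words_def)
  have ex1: "\<exists>!t. t \<in> transitions M \<and> source t = p \<and> letter t = \<alpha> i" if "p \<in> states M" for p i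
    using M(2) that \<alpha>' unfolding deterministic_def by blast
  have \<delta>: "\<delta> p (\<alpha> i) \<in> transitions M \<and> source (\<delta> p (\<alpha> i)) = p \<and> letter (\<delta> p (\<alpha> i)) = \<alpha> i"
    if "p \<in> states M" for p i
    unfolding \<delta>_def by (rule theI'[OF ex1[OF that]])
  have uniq: "t = \<delta> p (\<alpha> i)" if "p \<in> states M" "t \<in> transitions M" "source t = p" "letter t = \<alpha> i" for p i t
    using ex1[OF that(1), of i] \<delta>[OF that(1), of i] that(2-4) by blast
  define s where "s = rec_nat (initial M) (\<lambda>i p. target (\<delta> p (\<alpha> i)))"
  have s: "s 0 = initial M" "\<And>i. s (Suc i) = target (\<delta> (s i) (\<alpha> i))" by (simp_all add: s_def)
  have states: "s i \<in> states M" for i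
    by (induction i) (use M(1) \<delta> transition_states[OF M(1)] in \<open>auto simp: s limit_PA_def\<close>)
  show ?thesis
  proof (rule ex1I[of _ "\<lambda>i. \<delta> (s i) (\<alpha> i)"])
    show "is_run M \<alpha> (\<lambda>i. \<delta> (s i) (\<alpha> i))"
      using \<delta>[OF states] by (simp add: is_run_def flip: s)
    fix r assume r: "is_run M \<alpha> r"
    have step: "r i = \<delta> (s i) (\<alpha> i)" if "source (r i) = s i" for i
      using r by (intro uniq[OF states _ that]) (simp_all add: is_run_def)
    have "source (r i) = s i \<and> r i = \<delta> (s i) (\<alpha> i)" for i
    proof (induction i)
      case 0
      from r have "source (r 0) = s 0" by (simp add: is_run_def s)
      with step[OF this] show ?case by (rule conjI[rotated])
    next
      case (Suc i)
      from r Suc have "source (r (Suc i)) = s (Suc i)" by (simp add: is_run_def s)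
      with step[OF this] show ?case by (rule conjI[rotated])
    qed
    then show "r = (\<lambda>i. \<delta> (s i) (\<alpha> i))" by auto
  qed
qed

section \<open>Counter totals and the product automaton\<close>

definition total :: "(nat \<Rightarrow> nat) \<Rightarrow> enat" where
  "total f = (if infinite {i. f i \<noteq> 0} then \<infinity> else enat (\<Sum>i\<in>{i. f i \<noteq> 0}. f i))"

lemma total_weight_eq: "total_weight d r = map (\<lambda>j. total (\<lambda>i. weight (r i) ! j)) [0..<d]"
  by (simp add: total_weight_def total_def)

lemma total_of_bool: "total (\<lambda>i. of_bool (P i)) = \<infinity> \<longleftrightarrow> infinite {i. P i}"
  by (simp add: total_def)

lemma length_total_weight: "length (total_weight d r) = d"
  by (simp add: total_weight_eq)

lemma nth_total_weight: "j < d \<Longrightarrow> total_weight d r ! j = total (\<lambda>i. weight (r i) ! j)"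
  by (simp add: total_weight_eq)

text \<open>Counter layout: those of \<open>M\<close>, the flag of \<open>M\<close> at index
  \<open>dim M\<close>, those of \<open>N\<close> from \<open>dim M + 1\<close> on, and the flag of
  \<open>N\<close> last.\<close>

definition join where
  "join M N s t = ((source s, source t), letter s,
     weight s @ of_bool (target s \<in> accepting M) # weight t @ [of_bool (target t \<in> accepting N)],
     (target s, target t))"

lemma join_sel [simp]:
  "source (join M N s t) = (source s, source t)"
  "letter (join M N s t) = letter s"
  "target (join M N s t) = (target s, target t)"
  "weight (join M N s t) =
     weight s @ of_bool (target s \<in> accepting M) # weight t @ [of_bool (target t \<in> accepting N)]"
  by (simp_all add: join_def)

text \<open>All states are accepting because the flags already record the relevant visits. Leaving
  \<open>C\<close> open lets one construction serve all three Boolean operations.\<close>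

definition product where
  "product M N C = \<lparr>dim = dim M + dim N + 2, states = states M \<times> states N, alphabet = alphabet M,
     initial = (initial M, initial N),
     transitions = {join M N s t | s t. s \<in> transitions M \<and> t \<in> transitions N \<and> letter s = letter t},
     accepting = states M \<times> states N, constraint = C\<rparr>"

lemma product_sel [simp]:
  "dim (product M N C) = dim M + dim N + 2"
  "states (product M N C) = states M \<times> states N"
  "alphabet (product M N C) = alphabet M"
  "initial (product M N C) = (initial M, initial N)"
  "accepting (product M N C) = states M \<times> states N"
  "constraint (product M N C) = C"
  by (simp_all add: product_def)

lemma transitions_product:
  "transitions (product M N C) =
     {join M N s t | s t. s \<in> transitions M \<and> t \<in> transitions N \<and> letter s = letter t}"
  by (simp add: product_def)

lemma transition_productI:
  "s \<in> transitions M \<Longrightarrow> t \<in> transitions N \<Longrightarrow> letter s = letter t \<Longrightarrow>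
     join M N s t \<in> transitions (product M N C)"
  unfolding transitions_product by blast

locale det_pair =
  fixes M :: "('p, 'a) parikh_automaton" and N :: "('q, 'a) parikh_automaton"
  assumes M: "limit_PA M" "deterministic M" and N: "limit_PA N" "deterministic N"
    and alphabet: "alphabet N = alphabet M"
begin

abbreviation "D \<equiv> dim M + dim N + 2"

lemma limit_PA_product:
  assumes "semilinear_set D C"
  shows "limit_PA (product M N C)"
proof -
  have "transitions (product M N C) \<subseteq> (\<lambda>(s, t). join M N s t) ` (transitions M \<times> transitions N)"
    by (auto simp: transitions_product)
  moreover have "finite (transitions M)" "finite (transitions N)"
    using M(1) N(1) by (simp_all add: limit_PA_def)
  ultimately have "finite (transitions (product M N C))" by (meson finite_SigmaI finite_imageI finite_subset)
  moreover have "transitions (product M N C)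
      \<subseteq> states (product M N C) \<times> alphabet M \<times> {v. length v = D} \<times> states (product M N C)"
  proof
    fix u assume "u \<in> transitions (product M N C)"
    then obtain s t where "u = join M N s t" and s: "s \<in> transitions M" and t: "t \<in> transitions N"
      by (auto simp: transitions_product)
    then show "u \<in> states (product M N C) \<times> alphabet M \<times> {v. length v = D} \<times> states (product M N C)"
      using transition_states[OF M(1) s] transition_states[OF N(1) t] transition_letter[OF M(1) s]
        weight_length[OF M(1) s] weight_length[OF N(1) t]
      by (simp add: join_def)
  qed
  ultimately show ?thesis using M(1) N(1) assms by (simp add: limit_PA_def)
qed

lemma deterministic_product: "deterministic (product M N C)"
  unfolding deterministic_def
proof (intro ballI)
  fix pq a assume "pq \<in> states (product M N C)" and a: "a \<in> alphabet (product M N C)"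
  then obtain p q where pq: "pq = (p, q)" "p \<in> states M" "q \<in> states N" by auto
  have "\<exists>!s. s \<in> transitions M \<and> source s = p \<and> letter s = a"
    using M(2) pq(2) a by (simp add: deterministic_def)
  then obtain s where s: "s \<in> transitions M" "source s = p" "letter s = a"
    "\<And>s'. s' \<in> transitions M \<Longrightarrow> source s' = p \<Longrightarrow> letter s' = a \<Longrightarrow> s' = s" by blast
  have "\<exists>!t. t \<in> transitions N \<and> source t = q \<and> letter t = a"
    using N(2) pq(3) a alphabet by (simp add: deterministic_def)
  then obtain t where t: "t \<in> transitions N" "source t = q" "letter t = a"
    "\<And>t'. t' \<in> transitions N \<Longrightarrow> source t' = q \<Longrightarrow> letter t' = a \<Longrightarrow> t' = t" by blast
  show "\<exists>!u. u \<in> transitions (product M N C) \<and> source u = pq \<and> letter u = a"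
  proof (rule ex1I[of _ "join M N s t"])
    show "join M N s t \<in> transitions (product M N C) \<and> source (join M N s t) = pq \<and> letter (join M N s t) = a"
      using transition_productI[OF s(1) t(1)] s(2,3) t(2,3) pq by simp
    fix u assume "u \<in> transitions (product M N C) \<and> source u = pq \<and> letter u = a"
    then obtain s' t' where "u = join M N s' t'" "s' \<in> transitions M" "t' \<in> transitions N"
      "letter s' = a" "letter t' = a" "source s' = p" "source t' = q"
      using pq by (auto simp: transitions_product)
    then show "u = join M N s t" using s(4) t(4) by simp
  qed
qed

text \<open>Runs of the product are the joins of two runs on the same word, and its Buechi condition
  always holds.\<close>

lemma omega_language_product:
  "omega_language (product M N C) = {\<alpha> \<in> omega_words (alphabet M). \<exists>r r'.
     is_run M \<alpha> r \<and> is_run N \<alpha> r' \<and> total_weight D (\<lambda>i. join M N (r i) (r' i)) \<in> C}"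
proof -
  have "(\<exists>u. is_run (product M N C) \<alpha> u \<and> accepting_run (product M N C) u) \<longleftrightarrow>
    (\<exists>r r'. is_run M \<alpha> r \<and> is_run N \<alpha> r' \<and> total_weight D (\<lambda>i. join M N (r i) (r' i)) \<in> C)" for \<alpha>
  proof
    assume "\<exists>u. is_run (product M N C) \<alpha> u \<and> accepting_run (product M N C) u"
    then obtain u where u: "is_run (product M N C) \<alpha> u" "total_weight D u \<in> C"
      by (auto simp: accepting_run_def)
    then have "\<forall>i. \<exists>s t. u i = join M N s t \<and> s \<in> transitions M \<and> t \<in> transitions N \<and> letter s = letter t"
      unfolding is_run_def transitions_product by blast
    then obtain r r' where r: "\<And>i. u i = join M N (r i) (r' i)" "\<And>i. r i \<in> transitions M"
      "\<And>i. r' i \<in> transitions N" "\<And>i. letter (r i) = letter (r' i)" by metis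
    have u_eq: "u = (\<lambda>i. join M N (r i) (r' i))" using r(1) by auto
    have "is_run M \<alpha> r" "is_run N \<alpha> r'"
      using u(1) r(2-4) by (auto simp: is_run_def u_eq)
    with u(2) show "\<exists>r r'. is_run M \<alpha> r \<and> is_run N \<alpha> r' \<and> total_weight D (\<lambda>i. join M N (r i) (r' i)) \<in> C"
      unfolding u_eq by blast
  next
    assume "\<exists>r r'. is_run M \<alpha> r \<and> is_run N \<alpha> r' \<and> total_weight D (\<lambda>i. join M N (r i) (r' i)) \<in> C"
    then obtain r r' where r: "is_run M \<alpha> r" "is_run N \<alpha> r'"
      "total_weight D (\<lambda>i. join M N (r i) (r' i)) \<in> C" by blast
    let ?u = "\<lambda>i. join M N (r i) (r' i)"
    have "is_run (product M N C) \<alpha> ?u"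
      using r(1,2) by (simp add: is_run_def transition_productI)
    moreover have "target (?u i) \<in> accepting (product M N C)" for i
      using r(1,2) transition_states(2)[OF M(1)] transition_states(2)[OF N(1)] by (simp add: is_run_def)
    then have "accepting_run (product M N C) ?u"
      using r(3) by (simp add: accepting_run_def)
    ultimately show "\<exists>u. is_run (product M N C) \<alpha> u \<and> accepting_run (product M N C) u" by blast
  qed
  then show ?thesis by (simp add: omega_language_def)
qed

section \<open>Acceptance of the factors as a counter condition\<close>

definition fst_accepting where
  "fst_accepting = {v. length v = D \<and> map (\<lambda>i. v ! i) [0..<dim M] \<in> constraint M} \<inter>
     {v. length v = D \<and> v ! dim M = \<infinity>}"

definition snd_accepting where
  "snd_accepting = {v. length v = D \<and> map (\<lambda>i. v ! (dim M + 1 + i)) [0..<dim N] \<in> constraint N} \<inter>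
     {v. length v = D \<and> v ! (dim M + 1 + dim N) = \<infinity>}"

lemma definable_fst_accepting: "definable D fst_accepting"
  unfolding fst_accepting_def using M(1)
  by (intro definable_Int definable_reindex definable_infinite)
    (simp_all add: limit_PA_def semilinear_set_iff_definable)

lemma definable_snd_accepting: "definable D snd_accepting"
  unfolding snd_accepting_def using N(1)
  by (intro definable_Int definable_reindex definable_infinite)
    (simp_all add: limit_PA_def semilinear_set_iff_definable)

context
  fixes \<alpha> r r' assumes r: "is_run M \<alpha> r" and r': "is_run N \<alpha> r'"
begin

lemma length_weights: "length (weight (r i)) = dim M" "length (weight (r' i)) = dim N"
  using r r' weight_length[OF M(1)] weight_length[OF N(1)] by (simp_all add: is_run_def)

lemma nth_weight_join:
  "i < dim M \<Longrightarrow> weight (join M N (r k) (r' k)) ! i = weight (r k) ! i"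
  "weight (join M N (r k) (r' k)) ! dim M = of_bool (target (r k) \<in> accepting M)"
  "i < dim N \<Longrightarrow> weight (join M N (r k) (r' k)) ! (dim M + 1 + i) = weight (r' k) ! i"
  "weight (join M N (r k) (r' k)) ! (dim M + 1 + dim N) = of_bool (target (r' k) \<in> accepting N)"
  using length_weights[of k] by (simp_all add: nth_append)

lemma total_weight_fst_accepting:
  "total_weight D (\<lambda>i. join M N (r i) (r' i)) \<in> fst_accepting \<longleftrightarrow> accepting_run M r"
proof -
  let ?w = "total_weight D (\<lambda>i. join M N (r i) (r' i))"
  have "map (\<lambda>i. ?w ! i) [0..<dim M] = total_weight (dim M) r"
    by (simp add: total_weight_eq[of "dim M"] nth_total_weight nth_weight_join del: join_sel add_Suc_right One_nat_def)
  moreover have "?w ! dim M = \<infinity> \<longleftrightarrow> infinite {i. target (r i) \<in> accepting M}"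
    by (simp add: nth_total_weight nth_weight_join total_of_bool del: join_sel add_Suc_right One_nat_def)
  moreover have "length ?w = D" by (rule length_total_weight)
  ultimately show ?thesis by (auto simp: fst_accepting_def accepting_run_def)
qed

lemma total_weight_snd_accepting:
  "total_weight D (\<lambda>i. join M N (r i) (r' i)) \<in> snd_accepting \<longleftrightarrow> accepting_run N r'"
proof -
  let ?w = "total_weight D (\<lambda>i. join M N (r i) (r' i))"
  have "map (\<lambda>i. ?w ! (dim M + 1 + i)) [0..<dim N] = total_weight (dim N) r'"
    by (simp add: total_weight_eq[of "dim N"] nth_total_weight nth_weight_join del: join_sel add_Suc_right One_nat_def)
  moreover have "?w ! (dim M + 1 + dim N) = \<infinity> \<longleftrightarrow> infinite {i. target (r' i) \<in> accepting N}"
    by (simp add: nth_total_weight nth_weight_join total_of_bool del: join_sel add_Suc_right One_nat_def)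
  moreover have "length ?w = D" by (rule length_total_weight)
  ultimately show ?thesis by (auto simp: snd_accepting_def accepting_run_def)
qed

end

text \<open>Both automata have a run on every word, and any pair of runs decides membership in
  \<open>L\<close>. Closure properties thus reduce to the definability of \<open>C\<close>.\<close>

lemma recognizable_product:
  assumes "definable D C"
    and "\<And>\<alpha> r r'. \<alpha> \<in> omega_words (alphabet M) \<Longrightarrow> is_run M \<alpha> r \<Longrightarrow> is_run N \<alpha> r' \<Longrightarrow>
      \<alpha> \<in> L \<longleftrightarrow> total_weight D (\<lambda>i. join M N (r i) (r' i)) \<in> C"
    and "L \<subseteq> omega_words (alphabet M)"
  shows "det_limit_PA_recognizable (alphabet M) L"
proof -
  have "\<exists>r. is_run M \<alpha> r" "\<exists>r. is_run N \<alpha> r" if "\<alpha> \<in> omega_words (alphabet M)" for \<alpha>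
    using deterministic_run[OF M, of \<alpha>] deterministic_run[OF N, of \<alpha>] that
    unfolding alphabet by blast+
  then have "omega_language (product M N C) = L"
    using assms(2,3) unfolding omega_language_product by blast
  moreover have "det_limit_PA_recognizable (alphabet (product M N C)) (omega_language (product M N C))"
    using assms(1) by (intro det_limit_PA_recognizableI limit_PA_product deterministic_product)
      (simp add: semilinear_set_iff_definable)
  ultimately show ?thesis by simp
qed

text \<open>By uniqueness the given run is the only candidate, so rejection of a word is also a
  property of this one run.\<close>

lemma in_omega_language_fst:
  assumes "\<alpha> \<in> omega_words (alphabet M)" "is_run M \<alpha> r"
  shows "\<alpha> \<in> omega_language M \<longleftrightarrow> accepting_run M r"
  using assms deterministic_run[OF M assms(1)] by (auto simp: omega_language_def)

lemma in_omega_language_snd: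
  assumes "\<alpha> \<in> omega_words (alphabet M)" "is_run N \<alpha> r"
  shows "\<alpha> \<in> omega_language N \<longleftrightarrow> accepting_run N r"
  using assms deterministic_run[OF N, of \<alpha>] alphabet by (auto simp: omega_language_def)

lemma omega_language_subset:
  "omega_language M \<subseteq> omega_words (alphabet M)" "omega_language N \<subseteq> omega_words (alphabet M)"
  using alphabet by (auto simp: omega_language_def)

lemmas membership = in_omega_language_fst in_omega_language_snd
  total_weight_fst_accepting total_weight_snd_accepting

lemma recognizable_Un: "det_limit_PA_recognizable (alphabet M) (omega_language M \<union> omega_language N)"
  by (rule recognizable_product[OF definable_Un[OF definable_fst_accepting definable_snd_accepting]])
    (use omega_language_subset in \<open>auto simp: membership simp del: add_2_eq_Suc add_2_eq_Suc'\<close>)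

lemma recognizable_Int: "det_limit_PA_recognizable (alphabet M) (omega_language M \<inter> omega_language N)"
  by (rule recognizable_product[OF definable_Int[OF definable_fst_accepting definable_snd_accepting]])
    (use omega_language_subset in \<open>auto simp: membership simp del: add_2_eq_Suc add_2_eq_Suc'\<close>)

text \<open>Complementing \<open>fst_accepting\<close> covers both ways to reject: a violated
  constraint and a finite flag.\<close>

lemma recognizable_compl:
  "det_limit_PA_recognizable (alphabet M) (omega_words (alphabet M) - omega_language M)"
  by (rule recognizable_product[OF definable_compl[OF definable_fst_accepting]])
    (auto simp: membership length_total_weight simp del: add_2_eq_Suc add_2_eq_Suc')

end

theorem lemma2:
  fixes \<Sigma> :: "'a set" and L1 L2 :: "'a word set"
  assumes "finite \<Sigma>" and "\<Sigma> \<noteq> {}"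
    and "L1 \<subseteq> omega_words \<Sigma>" and "L2 \<subseteq> omega_words \<Sigma>"
    and "det_limit_PA_recognizable \<Sigma> L1" and "det_limit_PA_recognizable \<Sigma> L2"
  shows "det_limit_PA_recognizable \<Sigma> (L1 \<union> L2) \<and>
         det_limit_PA_recognizable \<Sigma> (L1 \<inter> L2) \<and>
         det_limit_PA_recognizable \<Sigma> (omega_words \<Sigma> - L1)"
proof -
  obtain M N :: "(nat, 'a) parikh_automaton" where
    M': "limit_PA M" "deterministic M" "alphabet M = \<Sigma>" "omega_language M = L1" and
    N': "limit_PA N" "deterministic N" "alphabet N = \<Sigma>" "omega_language N = L2"
    using assms(5,6) unfolding det_limit_PA_recognizable_def by blast
  interpret det_pair M N using M' N' by unfold_locales auto
  show ?thesis
    using recognizable_Un recognizable_Int recognizable_compl by (simp add: M' N')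
qed

end
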